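(* Assume $\lambda_0<\varepsilon-\eta\le0<A-\delta$ and $\rho>(A-\delta)(1-\gamma)$, and let the initial data $(k_0,c_0)$ be such that the initial structural state $q=(k_0,\ s\mapsto\varepsilon\int_{-\tau}^sc_0(u-s)e^{\eta u}du)$ belongs to $I$. Then the unique optimal pair $(k^*,c^* )$ of the internal habit problem (P) is the unique admissible pair satisfying, for all $t\ge0$, the closed-loop policy of the external habit economy $$\frac{c(t)-h(t)}{A-\delta-\Gamma}=k(t)-\frac{1}{A-\delta+\eta}\Big[h(t)+\varepsilon\big(1-e^{-(A-\delta+\eta)\tau}\big)k(t)-\varepsilon e^{-\eta\tau}e^{-(A-\delta)\tau}\int_{t-\tau}^{t}e^{-(A-\delta)(u-t)}\widetilde c(u)\,du\Big],$$ with $\Gamma=\frac{A-\delta-\rho}{\gamma}$. Consequently, with subtractive nonseparable utility and linear technology, internal habits and external habits (formed on average economy-wide consumption with the same $\varepsilon,\eta,\tau$) yield the same unique equilibrium path, and this path is Pareto optimal.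
   Context: Parameters $A,\delta,\rho,\varepsilon,\eta,\tau>0$, $\gamma>0$, $\gamma\ne1$; $\lambda_0$ is the unique real root of $1=\varepsilon\int_{-\tau}^0e^{(\lambda+\eta)u}du$. Problem (P) (internal habits): initial data $k_0>0$, $c_0\in L^2([-\tau,0);\mathbb{R}_+)$; for a control $c\ge0$, $\widetilde c$ is the concatenation of $c_0$ and $c$; habit $h(t)=\varepsilon\int_{t-\tau}^t\widetilde c(u)e^{\eta(u-t)}du$; capital $k(t)=k_0e^{(A-\delta)t}-\int_0^te^{(A-\delta)(t-u)}c(u)du$; admissible if $k\ge0$ and $c\ge h$ a.e.; maximize $\int_0^\infty\frac{(c(t)-h(t))^{1-\gamma}}{1-\gamma}e^{-\rho t}dt$. In the external habit economy the same utility is used but $h$ is formed from average consumption $\bar c$, taken as given by households; its market equilibrium (from prior work) is characterized by the displayed closed-loop policy. $G(x)=\big(1-\varepsilon\int_{-\tau}^0e^{(A-\delta+\eta)s}ds\big)x_0-\int_{-\tau}^0e^{(A-\delta)s}x_1(s)ds$ for $x=(x_0,x_1)\in\mathbb{R}\times L^2([-\tau,0])$; $I=\{x: G(x)>0,\ x_1\in W^{1,2}([-\tau,0]),\ x_1(-\tau)=0,\ x_1(s)>0\ \forall s\in(-\tau,0]\}$. *)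

theory Defs
  imports "HOL-Analysis.Analysis"
begin

text \<open>Internal habit problem (P) with linear technology and subtractive habits.
  Controls and initial data are real functions; only their values on the relevant
  intervals matter.\<close>

definition lambda0 :: "real \<Rightarrow> real \<Rightarrow> real \<Rightarrow> real" where
  "lambda0 eps eta tau =
     (THE l. 1 = eps * (\<integral>u\<in>{-tau..0}. exp ((l + eta) * u) \<partial>lborel))"

definition ctilde :: "(real \<Rightarrow> real) \<Rightarrow> (real \<Rightarrow> real) \<Rightarrow> real \<Rightarrow> real" where
  "ctilde c0 c t = (if t < 0 then c0 t else c t)"

definition habit :: "real \<Rightarrow> real \<Rightarrow> real \<Rightarrow> (real \<Rightarrow> real) \<Rightarrow> (real \<Rightarrow> real) \<Rightarrow> real \<Rightarrow> real" where
  "habit eps eta tau c0 c t =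
     eps * (\<integral>u\<in>{t - tau..t}. ctilde c0 c u * exp (eta * (u - t)) \<partial>lborel)"

definition capital :: "real \<Rightarrow> real \<Rightarrow> real \<Rightarrow> (real \<Rightarrow> real) \<Rightarrow> real \<Rightarrow> real" where
  "capital A delta k0 c t =
     k0 * exp ((A - delta) * t) - (\<integral>u\<in>{0..t}. exp ((A - delta) * (t - u)) * c u \<partial>lborel)"

definition admissible ::
  "real \<Rightarrow> real \<Rightarrow> real \<Rightarrow> real \<Rightarrow> real \<Rightarrow> real \<Rightarrow> (real \<Rightarrow> real) \<Rightarrow> (real \<Rightarrow> real) \<Rightarrow> bool" where
  "admissible A delta eps eta tau k0 c0 c \<longleftrightarrow>
     (\<forall>t\<ge>0. c t \<ge> 0) \<and>
     (\<forall>T\<ge>0. set_integrable lborel {0..T} c) \<and>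
     (\<forall>t\<ge>0. capital A delta k0 c t \<ge> 0) \<and>
     (AE t in lborel. t \<ge> 0 \<longrightarrow> c t \<ge> habit eps eta tau c0 c t)"

text \<open>Objective functional int_0^oo (c-h)^(1-gamma)/(1-gamma) e^{-rho t} dt, valued in the
  extended reals. The integrand has constant sign: for gamma < 1 it is nonnegative, for
  gamma > 1 it is nonpositive and equals -oo where c = h.\<close>
definition objective ::
  "real \<Rightarrow> real \<Rightarrow> real \<Rightarrow> real \<Rightarrow> real \<Rightarrow> (real \<Rightarrow> real) \<Rightarrow> (real \<Rightarrow> real) \<Rightarrow> ereal" where
  "objective rho gamma eps eta tau c0 c =
     (if gamma < 1 then
        enn2ereal (\<integral>\<^sup>+ t\<in>{0..}.
          ennreal ((max 0 (c t - habit eps eta tau c0 c t)) powr (1 - gamma) / (1 - gamma)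
                   * exp (- rho * t)) \<partial>lborel)
      else
        - enn2ereal (\<integral>\<^sup>+ t\<in>{0..}.
          (if c t - habit eps eta tau c0 c t > 0
           then ennreal ((c t - habit eps eta tau c0 c t) powr (1 - gamma) / (gamma - 1)
                         * exp (- rho * t))
           else \<infinity>) \<partial>lborel))"

definition optimal ::
  "real \<Rightarrow> real \<Rightarrow> real \<Rightarrow> real \<Rightarrow> real \<Rightarrow> real \<Rightarrow> real \<Rightarrow> real \<Rightarrow> (real \<Rightarrow> real) \<Rightarrow> (real \<Rightarrow> real) \<Rightarrow> bool" where
  "optimal A delta rho eps eta tau gamma k0 c0 c \<longleftrightarrow>
     admissible A delta eps eta tau k0 c0 c \<and>
     (\<forall>c'. admissible A delta eps eta tau k0 c0 c' \<longrightarrow>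
        objective rho gamma eps eta tau c0 c' \<le> objective rho gamma eps eta tau c0 c)"

definition G :: "real \<Rightarrow> real \<Rightarrow> real \<Rightarrow> real \<Rightarrow> real \<Rightarrow> real \<Rightarrow> (real \<Rightarrow> real) \<Rightarrow> real" where
  "G A delta eps eta tau x0 x1 =
     (1 - eps * (\<integral>s\<in>{-tau..0}. exp ((A - delta + eta) * s) \<partial>lborel)) * x0
     - (\<integral>s\<in>{-tau..0}. exp ((A - delta) * s) * x1 s \<partial>lborel)"

text \<open>W^{1,2}([a,b]): absolutely continuous with square-integrable derivative, i.e.
  f(s) = f(a) + int_a^s g for some g in L^2([a,b]).\<close>
definition W12 :: "real \<Rightarrow> real \<Rightarrow> (real \<Rightarrow> real) \<Rightarrow> bool" where
  "W12 a b f \<longleftrightarrow>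
     (\<exists>g. set_borel_measurable lborel {a..b} g \<and>
          set_integrable lborel {a..b} (\<lambda>s. (g s)\<^sup>2) \<and>
          (\<forall>s\<in>{a..b}. f s = f a + (\<integral>u\<in>{a..s}. g u \<partial>lborel)))"

definition setI :: "real \<Rightarrow> real \<Rightarrow> real \<Rightarrow> real \<Rightarrow> real \<Rightarrow> real \<Rightarrow> (real \<Rightarrow> real) \<Rightarrow> bool" where
  "setI A delta eps eta tau x0 x1 \<longleftrightarrow>
     G A delta eps eta tau x0 x1 > 0 \<and> W12 (-tau) 0 x1 \<and> x1 (-tau) = 0 \<and>
     (\<forall>s\<in>{-tau<..0}. x1 s > 0)"

definition q1 :: "real \<Rightarrow> real \<Rightarrow> real \<Rightarrow> (real \<Rightarrow> real) \<Rightarrow> real \<Rightarrow> real" where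
  "q1 eps eta tau c0 s = eps * (\<integral>u\<in>{-tau..s}. c0 (u - s) * exp (eta * u) \<partial>lborel)"

definition closed_loop ::
  "real \<Rightarrow> real \<Rightarrow> real \<Rightarrow> real \<Rightarrow> real \<Rightarrow> real \<Rightarrow> real \<Rightarrow> real \<Rightarrow> (real \<Rightarrow> real) \<Rightarrow> (real \<Rightarrow> real) \<Rightarrow> real \<Rightarrow> bool" where
  "closed_loop A delta rho eps eta tau gamma k0 c0 c t \<longleftrightarrow>
     (let Gam = (A - delta - rho) / gamma;
          h = habit eps eta tau c0 c t;
          k = capital A delta k0 c t
      in (c t - h) / (A - delta - Gam) =
         k - 1 / (A - delta + eta) *
           (h + eps * (1 - exp (- (A - delta + eta) * tau)) * k
              - eps * exp (- eta * tau) * exp (- (A - delta) * tau)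
                * (\<integral>u\<in>{t - tau..t}. exp (- (A - delta) * (u - t)) * ctilde c0 c u \<partial>lborel)))"

end

theory Submission
  imports Defs
begin

text \<open>Discount everything at the interest rate \<open>r = A - delta\<close>. Then the habit is a convolution of
  consumption with a kernel of mass \<open>1 - K < 1\<close>, and by Fubini the discounted functional G along a
  path (K times capital minus the habit still owed to past consumption) decreases exactly at the
  rate \<open>z\<close> of discounted consumption in excess of habit. Hence admissibility implies that \<open>z\<close>
  integrates to at most G(q), and the problem in terms of \<open>z\<close> is a problem without habits: the
  tangent line of the concave utility shows that its only solution is an exponential, which is also
  what the closed-loop policy prescribes. The consumption path is recovered from \<open>z\<close> uniquely because
  convolution with the kernel is a contraction, and capital stays nonnegative because G does.\<close>

section \<open>Real analysis\<close>

text \<open>The capital constraint binds at every time, yet optimality uses it only in the limit: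
  letting \<open>t\<close> tend to infinity leaves one linear budget, in which the price of a unit
  of \<open>z\<close> does not depend on time. The first-order condition therefore asks for a
  marginal utility of \<open>z\<close> that is constant along the path. With power utility this
  means an exponential of rate \<open>mu\<close>, and exhausting the budget fixes its coefficient
  \<open>mu * g0\<close>. The constraint relaxed in this way is verified afterwards, for this
  candidate alone.

  Two obstacles shape the rest. Controls are only integrable on bounded intervals, so the balance of
  wealth is derived for histories cut at a finite time, which the causality of the kernel permits.
  And policy and capital are conditions at every time, while the objective and the habit constraint
  ignore null sets. Since the convolution ignores them too, uniqueness almost everywhere can be
  sharpened wherever the data are pointwise.\<close>

lemma integral_singleton: "(\<integral>u\<in>{a..a}. f u \<partial>lborel) = (0::real)" for a :: real and f :: "real \<Rightarrow> real"
  unfolding set_lebesgue_integral_def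
  by (rule integral_eq_zero_AE) (use AE_lborel_singleton[of a] in \<open>auto elim: eventually_mono\<close>)

lemma integral_exp_decay:
  fixes a :: real
  assumes "a > 0"
  shows "set_integrable lborel {0..} (\<lambda>t. exp (- a * t))"
    and "(\<integral>t\<in>{0..}. exp (- a * t) \<partial>lborel) = 1 / a"
proof -
  have "((\<lambda>t. exp (- a * t)) \<longlongrightarrow> 0) at_top"
    using assms
    by (intro filterlim_compose[OF exp_at_bot]
        filterlim_tendsto_neg_mult_at_bot[OF tendsto_const _ filterlim_ident]) auto
  then have lim: "((\<lambda>t. - exp (- a * t) / a) \<longlongrightarrow> 0) at_top"
    using tendsto_divide[OF tendsto_minus tendsto_const, of _ 0 at_top a] assms by simp
  have nn: "(\<integral>\<^sup>+t. ennreal (exp (- a * t)) * indicator {0..} t \<partial>lborel)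
      = ennreal (0 - (- exp (- a * 0) / a))"
    using assms
    by (intro nn_integral_FTC_atLeast lim)
       (auto intro!: derivative_eq_intros)
  have eq: "(\<lambda>t. ennreal (exp (- a * t)) * indicator {0..} t)
      = (\<lambda>t. ennreal (indicator {0..} t *\<^sub>R exp (- a * t)))"
    by (auto simp: fun_eq_iff indicator_def)
  have "(\<integral>\<^sup>+t. ennreal (indicator {0..} t *\<^sub>R exp (- a * t)) \<partial>lborel) = ennreal (1 / a)"
    using nn unfolding eq by simp
  then have "has_bochner_integral lborel (\<lambda>t. indicator {0..} t *\<^sub>R exp (- a * t)) (1 / a)"
    using assms by (intro has_bochner_integral_nn_integral) auto
  then show "set_integrable lborel {0..} (\<lambda>t. exp (- a * t))"
    "(\<integral>t\<in>{0..}. exp (- a * t) \<partial>lborel) = 1 / a"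
    by (simp_all add: set_integrable_def set_lebesgue_integral_def has_bochner_integral_iff)
qed

text \<open>Strict concavity: the slope \<open>v powr (- gamma)\<close> decreases strictly. The last
  hypothesis excludes \<open>y = 0\<close> when \<open>gamma > 1\<close>, where
  \<open>0 powr (1 - gamma) = 0\<close> stands in for the true value minus infinity and the
  inequality fails.\<close>

lemma crra_below_tangent:
  fixes y s gamma :: real
  assumes "gamma > 0" "gamma \<noteq> 1" "s > 0" "y \<ge> 0" "y \<noteq> s" "gamma < 1 \<or> y > 0"
  shows "y powr (1 - gamma) / (1 - gamma)
    < s powr (1 - gamma) / (1 - gamma) + s powr (- gamma) * (y - s)"
proof (cases "y = 0")
  case True
  then have g: "gamma < 1" using assms by simp
  have "s powr (- gamma) * s = s powr (1 - gamma)"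
    using assms by (simp add: powr_diff powr_minus field_simps)
  moreover have "s powr (1 - gamma) < s powr (1 - gamma) / (1 - gamma)"
    using assms g by (simp add: field_simps)
  ultimately show ?thesis
    using True by (simp add: algebra_simps)
next
  case False
  \<comment> \<open>\<open>MVT2\<close> asks for a derivative on the closed interval; the power has
    none at 0, hence the separate case.\<close>
  let ?f = "\<lambda>v. v powr (1 - gamma) / (1 - gamma)"
  have der: "(?f has_real_derivative v powr (- gamma)) (at v)" if "v > 0" for v
    using that assms by (auto intro!: derivative_eq_intros)
  show ?thesis
  proof (cases "s < y")
    case True
    have "\<exists>v>s. v < y \<and> ?f y - ?f s = (y - s) * v powr (- gamma)"
      using True assms by (intro MVT2) (auto intro!: der)
    then obtain v where v: "s < v" "?f y - ?f s = (y - s) * v powr (- gamma)"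
      by blast
    have "v powr (- gamma) < s powr (- gamma)"
      using v assms by (simp add: powr_less_mono2_neg)
    then have "(y - s) * v powr (- gamma) < (y - s) * s powr (- gamma)"
      using True by simp
    then show ?thesis
      using v by (simp add: algebra_simps)
  next
    case 2: False
    have "\<exists>v>y. v < s \<and> ?f s - ?f y = (s - y) * v powr (- gamma)"
      using 2 False assms by (intro MVT2) (auto intro!: der)
    then obtain v where v: "y < v" "v < s" "?f s - ?f y = (s - y) * v powr (- gamma)"
      by blast
    have "s powr (- gamma) < v powr (- gamma)"
      using v assms by (simp add: powr_less_mono2_neg)
    then have "(s - y) * s powr (- gamma) < (s - y) * v powr (- gamma)"
      using 2 assms by simp
    then show ?thesis
      using v by (simp add: algebra_simps)
  qed
qed

text \<open>Only integrability is assumed, and the equation itself supplies the regularity: the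
  right side is continuous, hence so is \<open>g\<close>, hence the right side is differentiable,
  and then \<open>g t * exp (mu * t)\<close> has derivative zero.\<close>

lemma exponential_of_integral_equation:
  fixes g :: "real \<Rightarrow> real"
  assumes int: "\<And>T. T \<ge> 0 \<Longrightarrow> set_integrable lborel {0..T} g"
    and eq: "\<And>t. t \<ge> 0 \<Longrightarrow> g t = g0 - mu * (\<integral>u\<in>{0..t}. g u \<partial>lborel)"
    and T: "T \<ge> 0"
  shows "g T = g0 * exp (- mu * T)"
proof -
  have on: "g integrable_on {0..T}"
    using set_borel_integral_eq_integral(1)[OF int[OF T]] .
  have eq': "g t = g0 - mu * integral {0..t} g" if "t \<in> {0..T}" for t
    using eq[of t] set_borel_integral_eq_integral(2)[OF int[of t]] that by simp
  have cont: "continuous_on {0..T} g"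
    by (subst continuous_on_cong[OF refl eq'])
       (auto intro!: continuous_intros indefinite_integral_continuous_1 on)
  have "\<exists>c. \<forall>t\<in>{0..T}. g t * exp (mu * t) = c"
  proof (rule has_field_derivative_zero_constant)
    fix t assume t: "t \<in> {0..T}"
    have "((\<lambda>t. g0 - mu * integral {0..t} g) has_real_derivative - mu * g t) (at t within {0..T})"
      using integral_has_real_derivative[OF cont t] by (auto intro!: derivative_eq_intros)
    then have "(g has_real_derivative - mu * g t) (at t within {0..T})"
      by (rule has_field_derivative_transform_within[OF _ zero_less_one t]) (use eq' in auto)
    then show "((\<lambda>t. g t * exp (mu * t)) has_real_derivative 0) (at t within {0..T})"
      by (auto intro!: derivative_eq_intros simp: algebra_simps)
  qed simp
  moreover have "g 0 = g0"
    using eq'[of 0] T by simp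
  ultimately have "g T * exp (mu * T) = g0"
    using T by force
  then show ?thesis
    by (simp add: exp_minus field_simps)
qed

section \<open>Convolution with the habit kernel\<close>

locale delay_kernel =
  fixes eps beta tau :: real
  assumes eps_pos: "eps > 0" and tau_pos: "tau > 0" and eps_less_beta: "eps < beta"
begin

lemma beta_pos: "beta > 0"
  using eps_pos eps_less_beta by simp

text \<open>The indicator carries the delay window, so the habit is a convolution over the whole
  line and Fubini meets no moving limits. In the economy \<open>beta\<close> adds the interest rate
  to the decay rate \<open>eta\<close> of the habit.\<close>

definition ker :: "real \<Rightarrow> real" where
  "ker w = eps * exp (- beta * w) * indicator {0..tau} w"

text \<open>Both one minus the mass of \<open>ker\<close> and, for
  \<open>beta = A - delta + eta\<close>, the coefficient of capital in \<open>G\<close>.\<close>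

definition K :: real where
  "K = 1 - eps / beta * (1 - exp (- beta * tau))"

definition conv :: "(real \<Rightarrow> real) \<Rightarrow> real \<Rightarrow> real" where
  "conv x t = (\<integral>u. ker (t - u) * x u \<partial>lborel)"

lemma K_pos: "K > 0"
proof -
  have "eps * (1 - exp (- beta * tau)) < beta"
    using eps_pos eps_less_beta mult_left_mono[of "1 - exp (- beta * tau)" 1 eps]
    by (smt (verit) exp_gt_zero mult_cancel_left1)
  then show ?thesis
    unfolding K_def using beta_pos by (simp add: field_simps)
qed

lemma K_le_1: "K \<le> 1"
  unfolding K_def using beta_pos eps_pos tau_pos by simp

lemma ker_measurable [measurable]: "ker \<in> borel_measurable borel"
  unfolding ker_def[abs_def] by measurable

lemma ker_nonneg: "0 \<le> ker w"
  unfolding ker_def using eps_pos by (simp add: indicator_def)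

lemma ker_le: "ker w \<le> eps"
  unfolding ker_def using eps_pos beta_pos by (auto simp: indicator_def)

lemma ker_outside: "w < 0 \<or> tau < w \<Longrightarrow> ker w = 0"
  unfolding ker_def by (auto simp: indicator_def)

text \<open>Clamping \<open>a - u\<close> to \<open>[0, tau]\<close> puts three cases into one
  formula: \<open>a\<close> before the window (full mass), inside it, and beyond it (zero).\<close>

lemma has_integral_ker_tail:
  "has_bochner_integral lborel (\<lambda>t. ker (t - u) * indicator {a..} t)
     (eps / beta * (exp (- beta * min tau (max 0 (a - u))) - exp (- beta * tau)))"
proof (cases "a \<le> u + tau")
  case True
  let ?m = "max a u"
  have "has_bochner_integral lborel
      (\<lambda>t. (eps * exp (- beta * (t - u))) * indicator {?m..u + tau} t)
      ((- eps / beta * exp (- beta * (u + tau - u))) - (- eps / beta * exp (- beta * (?m - u))))"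
  proof (rule has_bochner_integral_FTC_Icc_real)
    show "?m \<le> u + tau"
      using True tau_pos by simp
    fix t
    show "((\<lambda>t. - eps / beta * exp (- beta * (t - u))) has_real_derivative
        eps * exp (- beta * (t - u))) (at t)"
      using beta_pos by (auto intro!: derivative_eq_intros)
  qed (auto intro!: continuous_intros)
  moreover have "(\<lambda>t. (eps * exp (- beta * (t - u))) * indicator {?m..u + tau} t)
      = (\<lambda>t. ker (t - u) * indicator {a..} t)"
    by (auto simp: ker_def indicator_def fun_eq_iff)
  moreover have "min tau (max 0 (a - u)) = ?m - u"
    using True tau_pos by auto
  ultimately show ?thesis
    by (simp add: diff_divide_distrib right_diff_distrib)
next
  case False
  then have "(\<lambda>t. ker (t - u) * indicator {a..} t) = (\<lambda>t. 0)"
    by (auto simp: ker_def indicator_def fun_eq_iff)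
  moreover have "min tau (max 0 (a - u)) = tau"
    using False tau_pos by auto
  ultimately show ?thesis
    by (simp add: has_bochner_integral_zero)
qed

lemma has_integral_ker: "has_bochner_integral lborel (\<lambda>t. ker (t - u)) (1 - K)"
proof -
  have "(\<lambda>t. ker (t - u) * indicator {u..} t) = (\<lambda>t. ker (t - u))"
    by (auto simp: ker_def indicator_def fun_eq_iff)
  then show ?thesis
    using has_integral_ker_tail[of u u] tau_pos by (simp add: K_def min_def)
qed

lemma integrable_ker_mult:
  assumes "integrable lborel x"
  shows "integrable lborel (\<lambda>u. ker (t - u) * x u)"
proof (rule Bochner_Integration.integrable_bound[of _ "\<lambda>u. eps * x u"])
  show "AE u in lborel. norm (ker (t - u) * x u) \<le> norm (eps * x u)"
    using ker_nonneg ker_le eps_pos by (auto simp: abs_mult intro!: mult_right_mono)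
  show "(\<lambda>u. ker (t - u) * x u) \<in> borel_measurable lborel"
    using assms by measurable
qed (use assms in simp)

text \<open>The nonnegative kernel has mass \<open>1 - K\<close> for every \<open>u\<close>, so the
  iterated integral of absolute values is at most \<open>1 - K\<close> times that of
  \<open>x\<close>, which justifies the exchange. \<open>S\<close> is left free: the whole line
  gives the total mass, a half-line the habit still to come.\<close>

lemma conv_Fubini:
  assumes x: "integrable lborel x" and S [measurable]: "S \<in> sets borel"
  shows "set_integrable lborel S (conv x)"
    and "(\<integral>t\<in>S. conv x t \<partial>lborel)
      = (\<integral>u. x u * (\<integral>t. ker (t - u) * indicator S t \<partial>lborel) \<partial>lborel)"
proof -
  have [measurable]: "x \<in> borel_measurable lborel"
    using x by simp
  let ?f = "\<lambda>u t. x u * (ker (t - u) * indicator S t)"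
  have kS: "integrable lborel (\<lambda>t. ker (t - u) * indicator S t)" for u
    using integrable_mult_indicator[of S lborel "\<lambda>t. ker (t - u)"] has_integral_ker[of u]
    by (auto simp: has_bochner_integral_iff mult.commute)
  have kS_le: "(\<integral>t. ker (t - u) * indicator S t \<partial>lborel) \<le> 1 - K" for u
    using integral_mono[OF kS[of u], of "\<lambda>t. ker (t - u)"] has_integral_ker[of u] ker_nonneg
    by (auto simp: has_bochner_integral_iff indicator_def)
  have kS_nonneg: "0 \<le> (\<integral>t. ker (t - u) * indicator S t \<partial>lborel)" for u
    by (rule integral_nonneg_AE) (auto simp: ker_nonneg)
  have "integrable (lborel \<Otimes>\<^sub>M lborel) (case_prod ?f)"
  proof (rule lborel_pair.Fubini_integrable)
    show "case_prod ?f \<in> borel_measurable (lborel \<Otimes>\<^sub>M lborel)"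
      by measurable
    have "(\<lambda>u. \<integral>t. norm (case_prod ?f (u, t)) \<partial>lborel)
        = (\<lambda>u. \<bar>x u\<bar> * (\<integral>t. ker (t - u) * indicator S t \<partial>lborel))"
      using ker_nonneg by (simp add: abs_mult)
    moreover have "integrable lborel (\<lambda>u. \<bar>x u\<bar> * (\<integral>t. ker (t - u) * indicator S t \<partial>lborel))"
    proof (rule Bochner_Integration.integrable_bound[of _ "\<lambda>u. (1 - K) * x u"])
      show "AE u in lborel. norm (\<bar>x u\<bar> * (\<integral>t. ker (t - u) * indicator S t \<partial>lborel))
          \<le> norm ((1 - K) * x u)"
        using kS_le kS_nonneg K_le_1
        by (auto simp: abs_mult mult.commute intro!: mult_left_mono)
    qed (use x in simp_all)
    ultimately show "integrable lborel (\<lambda>u. \<integral>t. norm (case_prod ?f (u, t)) \<partial>lborel)"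
      by simp
    show "AE u in lborel. integrable lborel (\<lambda>t. case_prod ?f (u, t))"
      using kS by simp
  qed
  from lborel_pair.Fubini_integral[OF this] lborel_pair.integrable_snd[OF this]
  have 1: "(\<integral>t. \<integral>u. ?f u t \<partial>lborel \<partial>lborel) = (\<integral>u. \<integral>t. ?f u t \<partial>lborel \<partial>lborel)"
    and 2: "integrable lborel (\<lambda>t. \<integral>u. ?f u t \<partial>lborel)"
    by simp_all
  have 3: "(\<integral>u. ?f u t \<partial>lborel) = indicator S t * conv x t" for t
    unfolding conv_def
    by (simp flip: integral_mult_right_zero) (simp add: mult_ac)
  show "set_integrable lborel S (conv x)"
    using 2 unfolding 3 set_integrable_def by simp
  show "(\<integral>t\<in>S. conv x t \<partial>lborel)
      = (\<integral>u. x u * (\<integral>t. ker (t - u) * indicator S t \<partial>lborel) \<partial>lborel)"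
    using 1 unfolding 3 set_lebesgue_integral_def by simp
qed

lemma integral_conv:
  assumes "integrable lborel x"
  shows "integrable lborel (conv x)" "(\<integral>t. conv x t \<partial>lborel) = (1 - K) * (\<integral>u. x u \<partial>lborel)"
  using conv_Fubini[OF assms, of UNIV] has_integral_ker
  by (simp_all add: set_integrable_def set_lebesgue_integral_def has_bochner_integral_iff)

text \<open>Cutting at \<open>T\<close> makes a locally integrable history integrable on the line.
  Because \<open>ker\<close> vanishes on negative arguments, the convolution up to time
  \<open>T\<close> does not notice the cut.\<close>

definition past :: "real \<Rightarrow> (real \<Rightarrow> real) \<Rightarrow> real \<Rightarrow> real" where
  "past T x u = indicator {..T} u * x u"

text \<open>The habit that the consumption of the past will still generate after time t.\<close>
definition pending :: "(real \<Rightarrow> real) \<Rightarrow> real \<Rightarrow> real" where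
  "pending x t = (\<integral>s\<in>{t..}. conv (past t x) s \<partial>lborel)"

lemma past_past: "S \<le> T \<Longrightarrow> past S (past T x) = past S x"
  by (auto simp: past_def fun_eq_iff indicator_def)

lemma conv_past: "t \<le> T \<Longrightarrow> conv (past T x) t = conv x t"
  unfolding conv_def
  by (rule Bochner_Integration.integral_cong) (auto simp: past_def indicator_def ker_outside)

lemma conv_nonneg: "(\<And>u. 0 \<le> x u) \<Longrightarrow> 0 \<le> conv x t"
  unfolding conv_def by (rule integral_nonneg_AE) (auto simp: ker_nonneg)

lemma conv_add:
  "integrable lborel x \<Longrightarrow> integrable lborel y \<Longrightarrow> conv (\<lambda>u. x u + y u) t = conv x t + conv y t"
  unfolding conv_def by (simp add: distrib_left integrable_ker_mult)

lemma conv_diff: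
  "integrable lborel x \<Longrightarrow> integrable lborel y \<Longrightarrow> conv (\<lambda>u. x u - y u) t = conv x t - conv y t"
  unfolding conv_def by (simp add: right_diff_distrib integrable_ker_mult)

lemma conv_future:
  assumes "s \<le> a"
  shows "conv (\<lambda>u. indicator {a<..} u * x u) s = 0"
proof -
  have "conv (\<lambda>u. indicator {a<..} u * x u) s = (\<integral>u. 0 \<partial>(lborel :: real measure))"
    unfolding conv_def using assms
    by (intro Bochner_Integration.integral_cong) (auto simp: indicator_def ker_outside)
  then show ?thesis by simp
qed

lemma pending_nonneg: "(\<And>u. 0 \<le> x u) \<Longrightarrow> 0 \<le> pending x t"
  unfolding pending_def set_lebesgue_integral_def
  by (intro integral_nonneg_AE always_eventually) (simp add: past_def conv_nonneg)

text \<open>By causality the part of \<open>x\<close> after 0 contributes nothing to the convolution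
  before 0, so on the half-line it already shows its full mass \<open>1 - K\<close>; the part before
  0 contributes \<open>pending x 0\<close>.\<close>

lemma integral_conv_from_0:
  assumes "integrable lborel x"
  shows "(\<integral>s\<in>{0..}. conv x s \<partial>lborel) = pending x 0 + (1 - K) * (\<integral>u\<in>{0<..}. x u \<partial>lborel)"
proof -
  let ?y = "\<lambda>u. indicator {0<..} u * x u"
  have y: "integrable lborel ?y"
    using integrable_mult_indicator[of "{0<..}" lborel x] assms by simp
  have c: "integrable lborel (past 0 x)"
    using integrable_mult_indicator[of "{..0}" lborel x] assms by (simp add: past_def[abs_def])
  have "x = (\<lambda>u. past 0 x u + ?y u)"
    by (auto simp: fun_eq_iff past_def indicator_def)
  then have split: "conv x s = conv (past 0 x) s + conv ?y s" for s
    using conv_add[OF c y] by metis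
  have eq: "(\<lambda>s. indicator {0..} s * conv ?y s) = conv ?y"
    using conv_future[of _ 0 x] by (auto simp: fun_eq_iff indicator_def)
  have "(\<integral>s\<in>{0..}. conv x s \<partial>lborel) = pending x 0 + (\<integral>s\<in>{0..}. conv ?y s \<partial>lborel)"
    unfolding split pending_def
    by (rule set_integral_add) (use conv_Fubini(1) c y in auto)
  also have "(\<integral>s\<in>{0..}. conv ?y s \<partial>lborel) = (1 - K) * (\<integral>u. ?y u \<partial>lborel)"
    using integral_conv(2)[OF y] unfolding set_lebesgue_integral_def real_scaleR_def eq .
  finally show ?thesis
    by (simp add: set_lebesgue_integral_def)
qed

text \<open>A balance: each unit of \<open>x\<close> adds \<open>1 - K\<close> to the habit owed,
  and the habit felt at time \<open>t\<close> is removed from it. The proof freezes \<open>x\<close>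
  at \<open>T\<close>, where all later convolution is exactly \<open>pending x T\<close>, and splits
  the half-line there.\<close>

lemma pending_flow:
  assumes x: "integrable lborel (past T x)" and T: "0 \<le> T"
  shows "set_integrable lborel {0..T} (conv x)"
    and "pending x T
      = pending x 0 + (1 - K) * (\<integral>u\<in>{0..T}. x u \<partial>lborel) - (\<integral>t\<in>{0..T}. conv x t \<partial>lborel)"
proof -
  have "set_integrable lborel {0..T} (conv (past T x))"
    using conv_Fubini(1)[OF x] by simp
  then show int: "set_integrable lborel {0..T} (conv x)"
    by (subst set_integrable_cong[where f' = "conv (past T x)"]) (auto simp: conv_past)
  have "(\<integral>s\<in>{0..}. conv (past T x) s \<partial>lborel)
      = (\<integral>s\<in>{0..T} \<union> {T..}. conv (past T x) s \<partial>lborel)"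
    using T by (intro arg_cong[where f = "\<lambda>S. set_lebesgue_integral lborel S _"]) auto
  also have "\<dots> = (\<integral>s\<in>{0..T}. conv (past T x) s \<partial>lborel) + pending x T"
    unfolding pending_def
  proof (rule set_integral_Un_AE)
    show "AE t in lborel. \<not> (t \<in> {0..T} \<and> t \<in> {T..})"
      using AE_lborel_singleton[of T] by eventually_elim auto
  qed (use conv_Fubini(1)[OF x] in auto)
  also have "(\<integral>s\<in>{0..T}. conv (past T x) s \<partial>lborel) = (\<integral>s\<in>{0..T}. conv x s \<partial>lborel)"
    by (rule set_lebesgue_integral_cong) (auto simp: conv_past)
  finally have "(\<integral>s\<in>{0..}. conv (past T x) s \<partial>lborel)
      = (\<integral>s\<in>{0..T}. conv x s \<partial>lborel) + pending x T" .
  moreover have "pending (past T x) 0 = pending x 0"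
    by (simp add: pending_def past_past T)
  moreover have "(\<integral>u\<in>{0<..}. past T x u \<partial>lborel) = (\<integral>u\<in>{0..T}. x u \<partial>lborel)"
  proof -
    have [measurable]: "past T x \<in> borel_measurable lborel"
      using x by simp
    have "(\<integral>u. indicator {0<..} u *\<^sub>R past T x u \<partial>lborel)
        = (\<integral>u. indicator {0..} u *\<^sub>R past T x u \<partial>lborel)"
    proof (rule integral_cong_AE)
      show "AE u in lborel. indicator {0<..} u *\<^sub>R past T x u = indicator {0..} u *\<^sub>R past T x u"
        using AE_lborel_singleton[of 0] by eventually_elim (auto simp: indicator_def)
    qed simp_all
    also have "(\<lambda>u. indicator {0..} u *\<^sub>R past T x u) = (\<lambda>u. indicator {0..T} u *\<^sub>R x u)"
      by (auto simp: past_def indicator_def fun_eq_iff)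
    finally show ?thesis
      by (simp add: set_lebesgue_integral_def)
  qed
  ultimately show "pending x T
      = pending x 0 + (1 - K) * (\<integral>u\<in>{0..T}. x u \<partial>lborel) - (\<integral>t\<in>{0..T}. conv x t \<partial>lborel)"
    using integral_conv_from_0[OF x] by simp
qed

text \<open>For an exponential kernel the tail after \<open>t\<close> is, inside the window, an
  affine function of its value at \<open>t\<close>. This is why the policy needs only the current
  habit and one further window integral.\<close>

lemma pending_eq:
  assumes x: "integrable lborel (past t x)"
  shows "pending x t
    = 1 / beta * (conv x t - eps * exp (- beta * tau) * (\<integral>u\<in>{t - tau..t}. x u \<partial>lborel))"
proof -
  have i1: "integrable lborel (\<lambda>u. ker (t - u) * past t x u)"
    by (rule integrable_ker_mult[OF x])
  have i2: "integrable lborel (\<lambda>u. indicator {t - tau..t} u * x u)"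
  proof -
    have "integrable lborel (\<lambda>u. indicator {t - tau..t} u *\<^sub>R past t x u)"
      by (rule integrable_mult_indicator) (use x in auto)
    also have "(\<lambda>u. indicator {t - tau..t} u *\<^sub>R past t x u) = (\<lambda>u. indicator {t - tau..t} u * x u)"
      by (auto simp: past_def indicator_def fun_eq_iff)
    finally show ?thesis .
  qed
  have "pending x t = (\<integral>u. past t x u * (eps / beta
      * (exp (- beta * min tau (max 0 (t - u))) - exp (- beta * tau))) \<partial>lborel)"
    unfolding pending_def conv_Fubini(2)[OF x, of "{t..}", simplified]
      has_bochner_integral_integral_eq[OF has_integral_ker_tail] ..
  also have "\<dots> = (\<integral>u. 1 / beta * (ker (t - u) * past t x u
      - eps * exp (- beta * tau) * (indicator {t - tau..t} u * x u)) \<partial>lborel)"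
    by (rule Bochner_Integration.integral_cong)
       (auto simp: past_def ker_def indicator_def min_def max_def field_simps)
  also have "\<dots> = 1 / beta * (conv (past t x) t
      - eps * exp (- beta * tau) * (\<integral>u. indicator {t - tau..t} u * x u \<partial>lborel))"
    using i1 i2 by (simp add: conv_def)
  finally show ?thesis
    by (simp add: conv_past set_lebesgue_integral_def)
qed

section \<open>Fixed points of the convolution: uniqueness and existence\<close>

lemma conv_fixed_point_unique:
  assumes d: "\<And>T. integrable lborel (past T d)"
    and eq: "AE t in lborel. d t = conv d t"
  shows "AE t in lborel. d t = 0" and "conv d t = 0"
proof -
  \<comment> \<open>Contraction in the L1 norm. The cut at \<open>T\<close> makes the norm finite,
    and it is bounded by \<open>1 - K\<close> times itself.\<close>
  have past0: "AE t in lborel. past T d t = 0" for T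
  proof -
    let ?D = "\<lambda>t. \<bar>past T d t\<bar>"
    have D: "integrable lborel ?D"
      using d by simp
    have "(\<integral>t. ?D t \<partial>lborel) \<le> (\<integral>t. conv ?D t \<partial>lborel)"
    proof (rule integral_mono_AE[OF D integral_conv(1)[OF D]])
      show "AE t in lborel. ?D t \<le> conv ?D t"
        using eq
      proof eventually_elim
        case (elim t)
        show ?case
        proof (cases "t \<le> T")
          case True
          have "?D t = \<bar>conv (past T d) t\<bar>"
            using True elim by (simp add: past_def conv_past)
          also have "\<dots> \<le> conv ?D t"
            unfolding conv_def using integral_norm_bound[of lborel "\<lambda>u. ker (t - u) * past T d u"]
            by (simp add: abs_mult ker_nonneg)
          finally show ?thesis .
        next
          case False
          then show ?thesis by (simp add: past_def conv_nonneg)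
        qed
      qed
    qed
    then have "(\<integral>t. ?D t \<partial>lborel) \<le> (1 - K) * (\<integral>t. ?D t \<partial>lborel)"
      by (simp add: integral_conv(2)[OF D])
    then have "K * (\<integral>t. ?D t \<partial>lborel) \<le> 0"
      by (simp add: algebra_simps)
    then have "(\<integral>t. ?D t \<partial>lborel) \<le> 0"
      using K_pos by (simp add: mult_le_0_iff)
    moreover have "0 \<le> (\<integral>t. ?D t \<partial>lborel)"
      by simp
    ultimately have "(\<integral>t. ?D t \<partial>lborel) = 0" by simp
    then show ?thesis
      using integral_nonneg_eq_0_iff_AE[OF D] by auto
  qed
  have "AE t in lborel. \<forall>n::nat. past (real n) d t = 0"
    using past0 by (simp add: AE_all_countable)
  then show zero: "AE t in lborel. d t = 0"
  proof eventually_elim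
    case (elim t)
    obtain n :: nat where "t \<le> real n"
      using real_arch_simple by blast
    then show ?case
      using elim[rule_format, of n] by (simp add: past_def)
  qed
  \<comment> \<open>This conclusion holds at every \<open>t\<close>, since an integral ignores the
    null set on which \<open>d\<close> may differ from zero.\<close>
  have "conv d t = conv (past t d) t" by (simp add: conv_past)
  also have "\<dots> = (\<integral>u. 0 \<partial>(lborel :: real measure))"
    unfolding conv_def
  proof (rule integral_cong_AE)
    show "(\<lambda>u. ker (t - u) * past t d u) \<in> borel_measurable lborel"
      using integrable_ker_mult[OF d[of t]] by simp
    show "AE u in lborel. ker (t - u) * past t d u = 0"
      using past0[of t] by eventually_elim simp
  qed simp
  finally show "conv d t = 0" by simp
qed

lemma nn_integral_ker: "(\<integral>\<^sup>+u. ennreal (ker (t - u)) \<partial>lborel) = ennreal (1 - K)"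
proof -
  have "(\<integral>\<^sup>+u. ennreal (ker (t - u)) \<partial>lborel) = (\<integral>\<^sup>+w. ennreal (ker w) \<partial>lborel)"
    using nn_integral_real_affine[of "\<lambda>w. ennreal (ker w)" "-1" t] by simp
  also have "\<dots> = ennreal (1 - K)"
    using nn_integral_eq_integral[of lborel ker] has_integral_ker[of 0] ker_nonneg
    by (simp add: has_bochner_integral_iff)
  finally show ?thesis .
qed

text \<open>Picard iteration from 0. As \<open>b\<close> and the kernel are nonnegative, the
  iterates increase, and monotone convergence in \<open>ennreal\<close> needs no integrability in
  advance; the limit solves the equation at every time and not just almost everywhere.\<close>

lemma conv_fixed_point_exists:
  assumes b [measurable]: "b \<in> borel_measurable borel"
    and b_nonneg: "\<And>t. 0 \<le> b t" and b_le: "\<And>t. b t \<le> B" and b_0: "\<And>t. t < 0 \<Longrightarrow> b t = 0"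
  obtains x where "x \<in> borel_measurable borel" "\<And>t. 0 \<le> x t" "\<And>t. x t \<le> B / K"
    "\<And>t. t < 0 \<Longrightarrow> x t = 0" "\<And>t. x t = b t + conv x t"
proof -
  define \<Phi> where "\<Phi> f t = ennreal (b t) + (\<integral>\<^sup>+u. ennreal (ker (t - u)) * f u \<partial>lborel)" for f t
  define F where "F n = (\<Phi> ^^ n) (\<lambda>_. 0)" for n
  have F_Suc: "F (Suc n) = \<Phi> (F n)" and F_0: "F 0 = (\<lambda>_. 0)" for n
    by (simp_all add: F_def)
  have F_meas [measurable]: "F n \<in> borel_measurable borel" for n
  proof (induction n)
    case (Suc n)
    note [measurable] = Suc
    show ?case
      unfolding F_Suc \<Phi>_def[abs_def] by measurable
  qed (simp add: F_0)
  have \<Phi>_mono: "f \<le> g \<Longrightarrow> \<Phi> f \<le> \<Phi> g" for f g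
    unfolding \<Phi>_def le_fun_def
    by (auto intro!: add_left_mono nn_integral_mono mult_left_mono)
  have "F n \<le> F (Suc n)" for n
  proof (induction n)
    case (Suc n)
    then show ?case by (simp only: F_Suc[of n] F_Suc[of "Suc n"] \<Phi>_mono)
  qed (simp add: F_0 le_fun_def)
  then have F_incseq: "incseq F"
    by (rule incseq_SucI)
  have B_nonneg: "0 \<le> B"
    using b_nonneg b_le order_trans by blast
  \<comment> \<open>\<open>B / K\<close> is the solution of \<open>M = B + (1 - K) * M\<close>, so
    the iteration reproduces this bound.\<close>
  have F_le: "F n t \<le> ennreal (B / K)" for n t
  proof (induction n arbitrary: t)
    case (Suc n)
    have "F (Suc n) t \<le> ennreal B + (\<integral>\<^sup>+u. ennreal (ker (t - u)) * ennreal (B / K) \<partial>lborel)"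
      unfolding F_Suc \<Phi>_def using Suc b_le
      by (intro add_mono nn_integral_mono mult_left_mono ennreal_leI) auto
    also have "\<dots> = ennreal B + ennreal (1 - K) * ennreal (B / K)"
      by (simp add: nn_integral_multc nn_integral_ker)
    also have "\<dots> = ennreal (B + (1 - K) * (B / K))"
      using B_nonneg K_pos K_le_1 by (simp add: ennreal_plus flip: ennreal_mult)
    also have "B + (1 - K) * (B / K) = B / K"
      using K_pos by (simp add: field_simps)
    finally show ?case .
  qed (simp add: F_0)
  have F_neg: "t < 0 \<Longrightarrow> F n t = 0" for n t
  proof (induction n arbitrary: t)
    case (Suc n)
    have "ennreal (ker (t - u)) * F n u = 0" for u
      using Suc by (cases "u < 0") (auto simp: ker_outside)
    then show ?case
      unfolding F_Suc \<Phi>_def using Suc.prems by (simp only: b_0) simp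
  qed (simp add: F_0)
  define L where "L t = (SUP n. F n t)" for t
  have [measurable]: "L \<in> borel_measurable borel"
    unfolding L_def[abs_def] by measurable
  have L_le: "L t \<le> ennreal (B / K)" for t
    unfolding L_def using F_le by (auto intro: SUP_least)
  have L_eq: "L t = ennreal (b t) + (\<integral>\<^sup>+u. ennreal (ker (t - u)) * L u \<partial>lborel)" for t
  proof -
    have "L t = (SUP n. F (Suc n) t)"
      unfolding L_def
    proof (rule SUP_eq)
      show "\<exists>j\<in>UNIV. F i t \<le> F (Suc j) t" for i
        using incseq_SucD[OF F_incseq, of i] by (auto simp: le_fun_def)
    qed auto
    also have "\<dots> = ennreal (b t) + (SUP n. \<integral>\<^sup>+u. ennreal (ker (t - u)) * F n u \<partial>lborel)"
      unfolding F_Suc \<Phi>_def by (rule ennreal_SUP_add_right[symmetric]) simp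
    also have "(SUP n. \<integral>\<^sup>+u. ennreal (ker (t - u)) * F n u \<partial>lborel)
        = (\<integral>\<^sup>+u. (SUP n. ennreal (ker (t - u)) * F n u) \<partial>lborel)"
      using F_incseq
      by (intro nn_integral_monotone_convergence_SUP[symmetric])
         (auto simp: incseq_def le_fun_def intro!: mult_left_mono)
    also have "\<dots> = (\<integral>\<^sup>+u. ennreal (ker (t - u)) * L u \<partial>lborel)"
      unfolding L_def by (simp add: SUP_mult_left_ennreal)
    finally show ?thesis .
  qed
  define x where "x t = enn2real (L t)" for t
  have [measurable]: "x \<in> borel_measurable borel"
    unfolding x_def[abs_def] by measurable
  have L_x: "L t = ennreal (x t)" for t
    unfolding x_def using L_le[of t] by (simp add: ennreal_enn2real top.not_eq_extremum le_less_trans)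
  have x_nonneg: "0 \<le> x t" for t
    by (simp add: x_def)
  have x_eq: "x t = b t + conv x t" for t
  proof -
    have eq: "(\<integral>\<^sup>+u. ennreal (ker (t - u)) * L u \<partial>lborel)
        = (\<integral>\<^sup>+u. ennreal (ker (t - u) * x u) \<partial>lborel)"
      by (simp add: L_x ennreal_mult ker_nonneg x_nonneg)
    have fin: "(\<integral>\<^sup>+u. ennreal (ker (t - u) * x u) \<partial>lborel) < \<infinity>"
    proof -
      have "(\<integral>\<^sup>+u. ennreal (ker (t - u) * x u) \<partial>lborel) \<le> L t"
        unfolding L_eq[of t] eq by (simp add: add_increasing)
      also have "\<dots> \<le> ennreal (B / K)"
        by (rule L_le)
      finally show ?thesis
        by (simp add: le_less_trans)
    qed
    have "integrable lborel (\<lambda>u. ker (t - u) * x u)"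
      using fin by (intro integrableI_nonneg) (auto simp: ker_nonneg x_nonneg)
    then have "(\<integral>\<^sup>+u. ennreal (ker (t - u) * x u) \<partial>lborel) = ennreal (conv x t)"
      unfolding conv_def by (intro nn_integral_eq_integral) (auto simp: ker_nonneg x_nonneg)
    then have "ennreal (x t) = ennreal (b t + conv x t)"
      using L_eq[of t] unfolding eq L_x[of t] by (simp add: b_nonneg conv_nonneg x_nonneg)
    then show ?thesis
      using x_nonneg b_nonneg conv_nonneg[OF x_nonneg] by (subst (asm) ennreal_inj) auto
  qed
  show thesis
  proof (rule that)
    show "x t \<le> B / K" for t
      using L_le[of t] B_nonneg K_pos unfolding L_x by simp
    show "x t = 0" if "t < 0" for t
      using F_neg[OF that] by (simp add: x_def L_def)
  qed (fact | rule x_nonneg x_eq)+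
qed

end

section \<open>The habit economy\<close>

locale habit_economy =
  fixes A delta r beta rho eps eta tau gamma k0 :: real and c0 :: "real \<Rightarrow> real"
  assumes r_eq: "A - delta = r" and beta_eq: "r + eta = beta"
    and eps_gt_0: "eps > 0" and tau_gt_0: "tau > 0" and eps_le_eta: "eps \<le> eta"
    and gamma_pos: "gamma > 0" and gamma_neq_1: "gamma \<noteq> 1"
    and r_pos: "0 < r" and rho_gt: "rho > r * (1 - gamma)"
    and c0_nonneg: "\<forall>u\<in>{-tau..<0}. c0 u \<ge> 0"
    and c0_measurable: "set_borel_measurable lborel {-tau..<0} c0"
    and c0_square_integrable: "set_integrable lborel {-tau..<0} (\<lambda>u. (c0 u)\<^sup>2)"
    and G_pos: "0 < G A delta eps eta tau k0 (q1 eps eta tau c0)"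
begin

text \<open>From \<open>eps \<le> eta\<close> and a positive interest rate,
  \<open>eps < r + eta = beta\<close>.\<close>

sublocale delay_kernel eps beta tau
  using beta_eq eps_gt_0 tau_gt_0 eps_le_eta r_pos by unfold_locales auto

text \<open>Consumption discounted at the interest rate, with the initial history attached. Discounting
  turns the habit into \<open>conv\<close> and makes the mass of the kernel, \<open>1 - K\<close>, less than one.\<close>
definition disc :: "(real \<Rightarrow> real) \<Rightarrow> real \<Rightarrow> real" where
  "disc c u = (if u < - tau then 0 else exp (- r * u) * ctilde c0 c u)"

definition surplus :: "(real \<Rightarrow> real) \<Rightarrow> real \<Rightarrow> real" where
  "surplus c t = disc c t - conv (disc c) t"

text \<open>The discounted value of the functional G along the path; see \<open>G_eq_wealth\<close> for time zero.\<close>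
definition wealth :: "(real \<Rightarrow> real) \<Rightarrow> real \<Rightarrow> real" where
  "wealth c t = K * (k0 - (\<integral>u\<in>{0..t}. disc c u \<partial>lborel)) - pending (disc c) t"

text \<open>This is \<open>A - delta - Gam\<close>, the denominator in the policy. It comes from the
  first-order condition: \<open>exp (r * t) * z\<close> must grow at the rate
  \<open>(r - rho) / gamma\<close>, so \<open>z\<close> decays at rate \<open>mu\<close>. Its
  positivity is equivalent to \<open>rho_gt\<close>.\<close>

definition mu :: real where
  "mu = r - (r - rho) / gamma"

definition locally_integrable :: "(real \<Rightarrow> real) \<Rightarrow> bool" where
  "locally_integrable c \<longleftrightarrow> (\<forall>T\<ge>0. set_integrable lborel {0..T} c)"

section \<open>Habit, capital and policy in discounted terms\<close>

lemma mu_pos: "mu > 0"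
  unfolding mu_def using rho_gt gamma_pos by (simp add: field_simps)

lemma disc_present: "t \<ge> 0 \<Longrightarrow> disc c t = exp (- r * t) * c t"
  using tau_gt_0 by (simp add: disc_def ctilde_def)

lemma ker_eq: "ker w = eps * exp (- r * w - eta * w) * indicator {0..tau} w"
proof -
  have "- beta * w = - r * w - eta * w"
    by (simp add: algebra_simps flip: beta_eq)
  then show ?thesis
    by (simp add: ker_def)
qed

text \<open>The cutoff in \<open>disc\<close> is invisible here: for \<open>t \<ge> 0\<close> the
  window \<open>[t - tau, t]\<close> reaches no further back than \<open>- tau\<close>.\<close>

lemma habit_eq:
  assumes "t \<ge> 0"
  shows "habit eps eta tau c0 c t = exp (r * t) * conv (disc c) t"
proof -
  have "habit eps eta tau c0 c t
      = (\<integral>u. eps * (indicator {t - tau..t} u * (ctilde c0 c u * exp (eta * (u - t)))) \<partial>lborel)"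
    by (simp add: habit_def set_lebesgue_integral_def)
  also have "\<dots> = (\<integral>u. exp (r * t) * (ker (t - u) * disc c u) \<partial>lborel)"
    using assms
    by (intro Bochner_Integration.integral_cong)
       (auto simp: ker_eq disc_def indicator_def algebra_simps simp flip: exp_add)
  finally show ?thesis
    by (simp add: conv_def)
qed

lemma surplus_eq:
  "t \<ge> 0 \<Longrightarrow> c t - habit eps eta tau c0 c t = exp (r * t) * surplus c t"
  by (simp add: surplus_def habit_eq disc_present algebra_simps flip: exp_add)

lemma capital_eq: "capital A delta k0 c t = exp (r * t) * (k0 - (\<integral>u\<in>{0..t}. disc c u \<partial>lborel))"
proof -
  have "(\<integral>u\<in>{0..t}. exp (r * (t - u)) * c u \<partial>lborel)
      = (\<integral>u. exp (r * t) * (indicator {0..t} u *\<^sub>R disc c u) \<partial>lborel)"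
    unfolding set_lebesgue_integral_def
    by (intro Bochner_Integration.integral_cong)
       (auto simp: disc_present indicator_def algebra_simps simp flip: exp_add)
  then show ?thesis
    by (simp add: capital_def set_lebesgue_integral_def r_eq right_diff_distrib mult.commute)
qed

text \<open>By \<open>pending_eq\<close> the right side of the policy is
  \<open>exp (r * t) * wealth c t\<close>, while the left side is
  \<open>exp (r * t) * surplus c t / mu\<close>.\<close>

lemma closed_loop_eq:
  assumes t: "t \<ge> 0" and int: "integrable lborel (past t (disc c))"
  shows "closed_loop A delta rho eps eta tau gamma k0 c0 c t \<longleftrightarrow> surplus c t = mu * wealth c t"
proof -
  have "(\<integral>u\<in>{t - tau..t}. exp (- r * (u - t)) * ctilde c0 c u \<partial>lborel)
      = (\<integral>u. exp (r * t) * (indicator {t - tau..t} u *\<^sub>R disc c u) \<partial>lborel)"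
    unfolding set_lebesgue_integral_def using t
    by (intro Bochner_Integration.integral_cong)
       (auto simp: disc_def indicator_def algebra_simps simp flip: exp_add)
  then have J: "(\<integral>u\<in>{t - tau..t}. exp (- r * (u - t)) * ctilde c0 c u \<partial>lborel)
      = exp (r * t) * (\<integral>u\<in>{t - tau..t}. disc c u \<partial>lborel)"
    by (simp add: set_lebesgue_integral_def)
  define I where "I = (\<integral>u\<in>{t - tau..t}. disc c u \<partial>lborel)"
  define k where "k = k0 - (\<integral>u\<in>{0..t}. disc c u \<partial>lborel)"
  define h where "h = conv (disc c) t"
  have e: "exp (- eta * tau) * exp (- r * tau) = exp (- beta * tau)"
    by (simp add: algebra_simps flip: exp_add beta_eq)
  have b: "beta \<noteq> 0"
    using beta_pos by simp
  have "closed_loop A delta rho eps eta tau gamma k0 c0 c t \<longleftrightarrow>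
    exp (r * t) * surplus c t / mu = exp (r * t) * k - 1 / beta *
      (exp (r * t) * h + eps * (1 - exp (- beta * tau)) * (exp (r * t) * k)
        - eps * (exp (- eta * tau) * exp (- r * tau)) * (exp (r * t) * I))"
    unfolding closed_loop_def Let_def surplus_eq[OF t]
    unfolding habit_eq[OF t] capital_eq r_eq J beta_eq
      mu_def[symmetric] I_def[symmetric] k_def[symmetric] h_def[symmetric]
    by (simp only: mult.assoc)
  also have "exp (r * t) * k - 1 / beta *
      (exp (r * t) * h + eps * (1 - exp (- beta * tau)) * (exp (r * t) * k)
        - eps * (exp (- eta * tau) * exp (- r * tau)) * (exp (r * t) * I))
    = exp (r * t) * (K * k - 1 / beta * (h - eps * exp (- beta * tau) * I))"
    unfolding e K_def using b by (simp add: field_simps)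
  also have "K * k - 1 / beta * (h - eps * exp (- beta * tau) * I) = wealth c t"
    by (simp add: wealth_def pending_eq[OF int] k_def h_def I_def)
  finally show ?thesis
    using mu_pos by (auto simp: field_simps)
qed

lemma integrable_initial: "set_integrable lborel {-tau..<0} c0"
proof -
  have "integrable lborel (\<lambda>u. indicator {-tau..<0} u *\<^sub>R (1 + (c0 u)\<^sup>2))"
    using set_integral_add(1)[of lborel "{-tau..<0}" "\<lambda>_. 1" "\<lambda>u. (c0 u)\<^sup>2"] c0_square_integrable
      tau_gt_0
    by (simp add: set_integrable_def integrable_real_indicator)
  then show ?thesis
    unfolding set_integrable_def
  proof (rule Bochner_Integration.integrable_bound)
    have "\<bar>a\<bar> \<le> 1 + a\<^sup>2" for a :: real
      using sum_squares_bound[of 1 "\<bar>a\<bar>"] by (auto simp: abs_if)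
    then show "AE u in lborel. norm (indicator {-tau..<0} u *\<^sub>R c0 u)
        \<le> norm (indicator {-tau..<0} u *\<^sub>R (1 + (c0 u)\<^sup>2))"
      by (auto simp: indicator_def)
  qed (use c0_measurable in \<open>simp add: set_borel_measurable_def\<close>)
qed

lemma integrable_past_disc:
  assumes c: "locally_integrable c"
  shows "integrable lborel (past T (disc c))"
proof -
  \<comment> \<open>\<open>locally_integrable\<close> speaks of nonnegative horizons only; for
    negative \<open>T\<close> the factor \<open>indicator {..T}\<close> removes the excess.\<close>
  define T' where "T' = max T 0"
  have int: "integrable lborel (\<lambda>u. indicator {-tau..<0} u *\<^sub>R c0 u + indicator {0..T'} u *\<^sub>R c u)"
    using integrable_initial c
    by (intro Bochner_Integration.integrable_add) (auto simp: locally_integrable_def set_integrable_def T'_def)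
  then have [measurable]:
    "(\<lambda>u. indicator {-tau..<0} u *\<^sub>R c0 u + indicator {0..T'} u *\<^sub>R c u) \<in> borel_measurable lborel"
    by simp
  have eq: "past T (disc c) = (\<lambda>u. indicator {..T} u * (exp (- r * u)
      * (indicator {-tau..<0} u *\<^sub>R c0 u + indicator {0..T'} u *\<^sub>R c u)))"
    using tau_gt_0 by (auto simp: past_def disc_def ctilde_def T'_def indicator_def fun_eq_iff)
  have "integrable lborel (\<lambda>u. indicator {..T} u * (exp (- r * u)
      * (indicator {-tau..<0} u *\<^sub>R c0 u + indicator {0..T'} u *\<^sub>R c u)))"
  proof (rule Bochner_Integration.integrable_bound)
    show "integrable lborel (\<lambda>u. exp (r * tau)
        * (indicator {-tau..<0} u *\<^sub>R c0 u + indicator {0..T'} u *\<^sub>R c u))"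
      using int by (rule integrable_mult_right)
    have "- r * u \<le> r * tau" if "- tau \<le> u" for u
      using mult_left_mono[OF that, of r] r_pos by simp
    then have "exp (- r * u) \<le> exp (r * tau)" if "- tau \<le> u" for u
      using that by simp
    then show "AE u in lborel. norm (indicator {..T} u * (exp (- r * u)
      * (indicator {-tau..<0} u *\<^sub>R c0 u + indicator {0..T'} u *\<^sub>R c u)))
      \<le> norm (exp (r * tau) * (indicator {-tau..<0} u *\<^sub>R c0 u + indicator {0..T'} u *\<^sub>R c u))"
      using tau_gt_0 by (auto simp: indicator_def abs_mult intro!: mult_right_mono)
  qed measurable
  then show ?thesis
    by (simp only: eq)
qed

lemma surplus_integrable:
  assumes c: "locally_integrable c" and "t \<ge> 0"
  shows "set_integrable lborel {0..t} (disc c)" "set_integrable lborel {0..t} (conv (disc c))"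
    "set_integrable lborel {0..t} (surplus c)"
proof -
  have "set_integrable lborel {0..t} (past t (disc c))"
    using integrable_mult_indicator[OF _ integrable_past_disc[OF c, of t], of "{0..t}"]
    by (simp add: set_integrable_def)
  then show 1: "set_integrable lborel {0..t} (disc c)"
    by (subst set_integrable_cong[where f' = "past t (disc c)"]) (auto simp: past_def)
  show 2: "set_integrable lborel {0..t} (conv (disc c))"
    using pending_flow(1)[OF integrable_past_disc[OF c] assms(2)] .
  show "set_integrable lborel {0..t} (surplus c)"
    unfolding surplus_def[abs_def] using 1 2 by (rule set_integral_diff)
qed

text \<open>A unit of discounted consumption costs \<open>K\<close> through capital and
  \<open>1 - K\<close> through the habit it creates, in total exactly one unit; the habit felt now
  is released. The net outflow is consumption minus habit.\<close>

lemma wealth_flow: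
  assumes c: "locally_integrable c" and t: "t \<ge> 0"
  shows "wealth c t = wealth c 0 - (\<integral>u\<in>{0..t}. surplus c u \<partial>lborel)"
proof -
  have "(\<integral>u\<in>{0..t}. surplus c u \<partial>lborel)
      = (\<integral>u\<in>{0..t}. disc c u \<partial>lborel) - (\<integral>u\<in>{0..t}. conv (disc c) u \<partial>lborel)"
    unfolding surplus_def using surplus_integrable[OF c t] by (intro set_integral_diff)
  then show ?thesis
    using pending_flow(2)[OF integrable_past_disc[OF c] t]
    by (simp add: wealth_def integral_singleton[of 0, simplified] algebra_simps)
qed

text \<open>\<open>past 0\<close> keeps the time 0, which belongs to the control and not to the
  history, so the integrands agree only off one point.\<close>

lemma pending_0_cong:
  assumes "locally_integrable c" "locally_integrable c'"
  shows "pending (disc c) 0 = pending (disc c') 0"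
proof -
  have "conv (past 0 (disc c)) s = conv (past 0 (disc c')) s" for s
    unfolding conv_def
  proof (rule integral_cong_AE)
    show "AE u in lborel. ker (s - u) * past 0 (disc c) u = ker (s - u) * past 0 (disc c') u"
      using AE_lborel_singleton[of 0]
      by eventually_elim (auto simp: past_def disc_def ctilde_def indicator_def)
  qed (use integrable_ker_mult[OF integrable_past_disc] assms in auto)
  then show ?thesis
    by (simp add: pending_def)
qed

text \<open>\<open>q1 eps eta tau c0 s\<close> is the habit that the history alone generates at time
  \<open>- s\<close>. Reflection turns the interval \<open>[-tau, 0]\<close> into
  \<open>[0, tau]\<close>, after which the history has left the window.\<close>

lemma integral_q1:
  assumes "locally_integrable c"
  shows "(\<integral>s\<in>{-tau..0}. exp (r * s) * q1 eps eta tau c0 s \<partial>lborel) = pending (disc c) 0"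
proof -
  \<comment> \<open>This control makes \<open>D 0 = c0 0\<close>, the value \<open>q1\<close> uses
    at its upper limit, so the integrands below agree pointwise.\<close>
  define D where "D = disc (\<lambda>_. c0 0)"
  have li: "locally_integrable (\<lambda>_. c0 0)"
    by (simp add: locally_integrable_def set_integrable_def)
  have q1: "exp (r * s) * q1 eps eta tau c0 s = conv (past 0 D) (- s)" if s: "s \<in> {-tau..0}" for s
  proof -
    have "exp (r * s) * q1 eps eta tau c0 s = exp (r * s) * (eps *
        (\<integral>v. indicator {-tau..s} v * (c0 (v - s) * exp (eta * v)) \<partial>lborel))"
      by (simp add: q1_def set_lebesgue_integral_def)
    also have "(\<integral>v. indicator {-tau..s} v * (c0 (v - s) * exp (eta * v)) \<partial>lborel)
        = (\<integral>u. indicator {-tau..s} (s + u) * (c0 u * exp (eta * (s + u))) \<partial>lborel)"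
      by (subst lborel_integral_real_affine[of 1 _ s]) simp_all
    also have "exp (r * s) * (eps * \<dots>)
        = (\<integral>u. exp (r * s) * (eps *
            (indicator {-tau..s} (s + u) * (c0 u * exp (eta * (s + u))))) \<partial>lborel)"
      by simp
    also have "\<dots> = (\<integral>u. ker (- s - u) * past 0 D u \<partial>lborel)"
      using s
      by (intro Bochner_Integration.integral_cong)
         (auto simp: D_def ker_eq past_def disc_def ctilde_def indicator_def algebra_simps
            simp flip: exp_add)
    finally show ?thesis
      by (simp add: conv_def)
  qed
  have zero: "conv (past 0 D) s = 0" if "s > tau" for s
  proof -
    have "ker (s - u) * past 0 D u = 0" for u
      using that by (cases "u \<le> 0") (auto simp: past_def ker_outside)
    then show ?thesis by (simp only: conv_def) simp
  qed
  have "(\<integral>s\<in>{-tau..0}. exp (r * s) * q1 eps eta tau c0 s \<partial>lborel)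
      = (\<integral>s. indicator {-tau..0} s *\<^sub>R conv (past 0 D) (- s) \<partial>lborel)"
    unfolding set_lebesgue_integral_def
    by (intro Bochner_Integration.integral_cong) (auto simp: q1 indicator_def)
  also have "\<dots> = (\<integral>s. indicator {-tau..0} (- s) *\<^sub>R conv (past 0 D) s \<partial>lborel)"
    by (subst lborel_integral_real_affine[of "-1" _ 0]) simp_all
  also have "\<dots> = pending D 0"
    unfolding pending_def set_lebesgue_integral_def
    by (intro Bochner_Integration.integral_cong)
       (auto simp: indicator_def not_le intro!: zero)
  finally show ?thesis
    unfolding D_def using pending_0_cong[OF li assms] by simp
qed

lemma G_eq_wealth:
  assumes "locally_integrable c"
  shows "G A delta eps eta tau k0 (q1 eps eta tau c0) = wealth c 0"
proof -
  have "has_bochner_integral lborel (\<lambda>s. exp (beta * s) * indicator {-tau..0} s)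
     (exp (beta * 0) / beta - exp (beta * (- tau)) / beta)"
    using tau_gt_0 beta_pos
    by (intro has_bochner_integral_FTC_Icc_real)
       (auto intro!: derivative_eq_intros continuous_intros)
  then have "(\<integral>s\<in>{-tau..0}. exp (beta * s) \<partial>lborel) = (1 - exp (- beta * tau)) / beta"
    by (simp add: has_bochner_integral_iff set_lebesgue_integral_def mult.commute[of _ "indicator _ _"] diff_divide_distrib)
  then show ?thesis
    by (simp add: G_def wealth_def integral_singleton[of 0, simplified] r_eq beta_eq integral_q1[OF assms] K_def)
qed

definition g0 :: real where
  "g0 = G A delta eps eta tau k0 (q1 eps eta tau c0)"

text \<open>The closed-loop policy is \<open>surplus = mu * wealth\<close>; since wealth decreases at the rate
  \<open>surplus\<close>, this forces the following exponential.\<close>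
definition zs :: "real \<Rightarrow> real" where
  "zs t = mu * g0 * exp (- mu * t)"

definition util :: "real \<Rightarrow> real \<Rightarrow> real" where
  "util z t = (exp (r * t) * z) powr (1 - gamma) / (1 - gamma) * exp (- rho * t)"

section \<open>The exponential candidate and its tangent line\<close>

lemma g0_pos: "g0 > 0"
  using G_pos by (simp add: g0_def)

lemma wealth_0: "locally_integrable c \<Longrightarrow> wealth c 0 = g0"
  by (simp add: g0_def G_eq_wealth)

lemma zs_pos: "zs t > 0"
  unfolding zs_def using mu_pos g0_pos by simp

lemma gamma_mu: "gamma * (r - mu) = r - rho"
  unfolding mu_def using gamma_pos by (simp add: field_simps)

lemma util_zs: "util (zs t) t = (mu * g0) powr (1 - gamma) / (1 - gamma) * exp (- mu * t)"
proof -
  have "exp (r * t) * zs t = mu * g0 * exp ((r - mu) * t)"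
    by (simp add: zs_def algebra_simps flip: exp_add)
  then have "(exp (r * t) * zs t) powr (1 - gamma) * exp (- rho * t)
      = (mu * g0) powr (1 - gamma) * (exp ((1 - gamma) * ((r - mu) * t)) * exp (- rho * t))"
    using mu_pos g0_pos by (simp add: powr_mult exp_powr_real mult.commute)
  also have "exp ((1 - gamma) * ((r - mu) * t)) * exp (- rho * t) = exp (- mu * t)"
  proof -
    have "(1 - gamma) * ((r - mu) * t) = (r - mu) * t - (gamma * (r - mu)) * t"
      by (simp add: algebra_simps)
    then have "(1 - gamma) * ((r - mu) * t) + - rho * t = - mu * t"
      unfolding gamma_mu by (simp add: algebra_simps)
    then show ?thesis
      by (simp flip: exp_add)
  qed
  finally show ?thesis
    by (simp add: util_def)
qed

text \<open>The slope is the Lagrange multiplier of the budget. It is free of \<open>t\<close>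
  because \<open>gamma * (r - mu) = r - rho\<close> cancels every exponential, so after integration
  only the total of \<open>z\<close> matters.\<close>

lemma util_tangent:
  assumes "0 \<le> z" "gamma < 1 \<or> 0 < z" "z \<noteq> zs t"
  shows "util z t < util (zs t) t + (mu * g0) powr (- gamma) * (z - zs t)"
proof -
  let ?e = "exp (r * t)"
  have "?e * zs t = mu * g0 * exp ((r - mu) * t)"
    by (simp add: zs_def algebra_simps flip: exp_add)
  then have "(?e * zs t) powr (- gamma) * (?e * exp (- rho * t))
      = (mu * g0) powr (- gamma) * (exp (- gamma * ((r - mu) * t)) * (?e * exp (- rho * t)))"
    using mu_pos g0_pos by (simp add: powr_mult exp_powr_real mult.commute)
  also have "exp (- gamma * ((r - mu) * t)) * (?e * exp (- rho * t)) = 1"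
  proof -
    have "- gamma * ((r - mu) * t) = - (gamma * (r - mu)) * t"
      by simp
    then have "- gamma * ((r - mu) * t) + (r * t + - rho * t) = 0"
      unfolding gamma_mu by (simp add: algebra_simps)
    then show ?thesis
      by (simp flip: exp_add)
  qed
  finally have slope: "(?e * zs t) powr (- gamma) * (?e * exp (- rho * t)) = (mu * g0) powr (- gamma)"
    by simp
  have "(?e * z) powr (1 - gamma) / (1 - gamma)
      < (?e * zs t) powr (1 - gamma) / (1 - gamma) + (?e * zs t) powr (- gamma) * (?e * z - ?e * zs t)"
    using assms gamma_pos gamma_neq_1 zs_pos by (intro crra_below_tangent) auto
  then have "util z t < ((?e * zs t) powr (1 - gamma) / (1 - gamma)
      + (?e * zs t) powr (- gamma) * (?e * z - ?e * zs t)) * exp (- rho * t)"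
    unfolding util_def by (rule mult_strict_right_mono) simp
  also have "\<dots> = util (zs t) t
      + ((?e * zs t) powr (- gamma) * (?e * exp (- rho * t))) * (z - zs t)"
    by (simp add: util_def algebra_simps)
  finally show ?thesis
    unfolding slope .
qed

lemma zs_integral:
  "set_integrable lborel {0..} zs" "(\<integral>t\<in>{0..}. zs t \<partial>lborel) = g0"
  "set_integrable lborel {0..} (\<lambda>t. util (zs t) t)"
  using integral_exp_decay[OF mu_pos] mu_pos unfolding zs_def[abs_def] util_zs[unfolded zs_def]
  by simp_all

section \<open>Budget and comparison for arbitrary admissible controls\<close>

lemma admissible_locally_integrable:
  "admissible A delta eps eta tau k0 c0 c \<Longrightarrow> locally_integrable c"
  by (simp add: admissible_def locally_integrable_def)

lemma disc_nonneg:
  assumes "\<And>t. t \<ge> 0 \<Longrightarrow> c t \<ge> 0"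
  shows "0 \<le> disc c u"
  using assms c0_nonneg by (auto simp: disc_def ctilde_def)

text \<open>Nonnegative capital bounds discounted consumption on \<open>[0, t]\<close> by
  \<open>k0\<close> for every \<open>t\<close>; monotone convergence carries the bound to the
  half-line.\<close>

lemma admissible_integrable_disc:
  assumes adm: "admissible A delta eps eta tau k0 c0 c"
  shows "integrable lborel (disc c)" "(\<integral>u\<in>{0..}. disc c u \<partial>lborel) \<le> k0"
proof -
  note li = admissible_locally_integrable[OF adm]
  have nn: "0 \<le> disc c u" for u
    using adm by (intro disc_nonneg) (auto simp: admissible_def)
  have le: "(\<integral>u\<in>{0..t}. disc c u \<partial>lborel) \<le> k0" if "t \<ge> 0" for t
    using adm that by (auto simp: admissible_def capital_eq zero_le_mult_iff)
  have int: "integrable lborel (\<lambda>u. indicator {0..real n} u * disc c u)" for n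
    using surplus_integrable(1)[OF li, of "real n"] by (simp add: set_integrable_def)
  let ?I = "\<lambda>n. \<integral>u. indicator {0..real n} u * disc c u \<partial>lborel"
  have I_le: "?I n \<le> k0" for n
    using le[of "real n"] by (simp add: set_lebesgue_integral_def)
  have mono: "mono (\<lambda>n. indicator {0..real n} u * disc c u)" for u
    by (auto simp: mono_def indicator_def nn)
  have "incseq ?I"
    by (intro incseq_SucI integral_mono int) (auto simp: indicator_def nn)
  then obtain L where L: "?I \<longlonglongrightarrow> L" "\<And>n. ?I n \<le> L"
    using incseq_convergent[of ?I k0] I_le by blast
  have lim: "(\<lambda>n. indicator {0..real n} u * disc c u) \<longlonglongrightarrow> indicator {0..} u * disc c u" for u
  proof (rule tendsto_eventually)
    obtain N :: nat where "u \<le> real N"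
      using real_arch_simple by blast
    then show "\<forall>\<^sub>F n in sequentially. indicator {0..real n} u * disc c u = indicator {0..} u * disc c u"
      by (intro eventually_sequentiallyI[of N]) (auto simp: indicator_def)
  qed
  have meas: "(\<lambda>u. indicator {0..} u * disc c u) \<in> borel_measurable lborel"
    by (rule borel_measurable_LIMSEQ_real[OF lim]) (use int in auto)
  have "has_bochner_integral lborel (\<lambda>u. indicator {0..} u * disc c u) L"
    using integrable_monotone_convergence[OF int _ _ L(1) meas]
      integral_monotone_convergence[OF int _ _ L(1) meas] mono lim
    by (simp add: has_bochner_integral_iff)
  moreover have "L \<le> k0"
    using L(1) I_le by (intro LIMSEQ_le_const2) auto
  ultimately show "(\<integral>u\<in>{0..}. disc c u \<partial>lborel) \<le> k0"
    by (simp add: has_bochner_integral_iff set_lebesgue_integral_def)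
  have "integrable lborel (\<lambda>u. indicator {0..} u * disc c u + indicator {..<0} u *\<^sub>R past 0 (disc c) u)"
    using \<open>has_bochner_integral lborel _ L\<close>
    by (intro Bochner_Integration.integrable_add integrable_mult_indicator integrable_past_disc li)
       (auto simp: has_bochner_integral_iff)
  also have "(\<lambda>u. indicator {0..} u * disc c u + indicator {..<0} u *\<^sub>R past 0 (disc c) u) = disc c"
    by (auto simp: fun_eq_iff past_def indicator_def)
  finally show "integrable lborel (disc c)" .
qed

text \<open>Integrating up to infinity avoids a sign claim for \<open>wealth\<close> at finite
  times, where nonnegative capital alone does not help because \<open>pending\<close> is subtracted.
  In the limit \<open>surplus\<close> totals \<open>K\<close> times discounted consumption minus the
  initial \<open>pending\<close>, and \<open>K > 0\<close> lets the bound \<open>k0\<close>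
  enter.\<close>

lemma surplus_budget:
  assumes adm: "admissible A delta eps eta tau k0 c0 c"
  shows "set_integrable lborel {0..} (surplus c)" "(\<integral>t\<in>{0..}. surplus c t \<partial>lborel) \<le> g0"
proof -
  note int = admissible_integrable_disc[OF adm]
  have d: "set_integrable lborel {0..} (disc c)"
    using integrable_mult_indicator[OF _ int(1), of "{0..}"] by (simp add: set_integrable_def)
  have c: "set_integrable lborel {0..} (conv (disc c))"
    using conv_Fubini(1)[OF int(1)] by simp
  show "set_integrable lborel {0..} (surplus c)"
    unfolding surplus_def[abs_def] using d c by (rule set_integral_diff)
  have [measurable]: "disc c \<in> borel_measurable lborel"
    using int by simp
  have "(\<integral>u\<in>{0<..}. disc c u \<partial>lborel) = (\<integral>u\<in>{0..}. disc c u \<partial>lborel)"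
    unfolding set_lebesgue_integral_def
    by (rule integral_cong_AE)
       (use AE_lborel_singleton[of 0] in \<open>auto simp: indicator_def elim: eventually_mono\<close>)
  then have "(\<integral>t\<in>{0..}. surplus c t \<partial>lborel) = K * (\<integral>u\<in>{0..}. disc c u \<partial>lborel) - pending (disc c) 0"
    unfolding surplus_def using set_integral_diff(2)[OF d c] integral_conv_from_0[OF int(1)]
    by (simp add: algebra_simps)
  also have "\<dots> \<le> wealth c 0"
    using int(2) K_pos by (simp add: wealth_def integral_singleton[of 0, simplified])
  finally show "(\<integral>t\<in>{0..}. surplus c t \<partial>lborel) \<le> g0"
    using wealth_0[OF admissible_locally_integrable[OF adm]] by simp
qed

lemma admissible_surplus_nonneg:
  assumes "admissible A delta eps eta tau k0 c0 c"
  shows "AE t in lborel. t \<ge> 0 \<longrightarrow> surplus c t \<ge> 0"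
proof -
  have "AE t in lborel. t \<ge> 0 \<longrightarrow> c t \<ge> habit eps eta tau c0 c t"
    using assms by (simp add: admissible_def)
  then show ?thesis
  proof eventually_elim
    case (elim t)
    show ?case
    proof
      assume "t \<ge> 0"
      then have "0 \<le> exp (r * t) * surplus c t"
        using elim surplus_eq[of t c] by simp
      then show "0 \<le> surplus c t"
        by (simp add: zero_le_mult_iff)
    qed
  qed
qed

text \<open>\<open>gap\<close> is the distance of utility below its tangent at \<open>zs\<close>. It
  is nonnegative almost everywhere, and since the multiplier is nonnegative and the budget holds,
  its integral is at most the loss of utility. A zero loss makes \<open>gap\<close> vanish almost
  everywhere, and strict concavity then identifies \<open>surplus\<close>.\<close>

lemma util_integral_le:
  assumes adm: "admissible A delta eps eta tau k0 c0 c"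
    and pos: "gamma < 1 \<or> (AE t in lborel. t \<ge> 0 \<longrightarrow> surplus c t > 0)"
    and int: "set_integrable lborel {0..} (\<lambda>t. util (surplus c t) t)"
  shows "(\<integral>t\<in>{0..}. util (surplus c t) t \<partial>lborel) \<le> (\<integral>t\<in>{0..}. util (zs t) t \<partial>lborel)"
    and "(\<integral>t\<in>{0..}. util (surplus c t) t \<partial>lborel) = (\<integral>t\<in>{0..}. util (zs t) t \<partial>lborel)
      \<Longrightarrow> AE t in lborel. t \<ge> 0 \<longrightarrow> surplus c t = zs t"
proof -
  define lam where "lam = (mu * g0) powr (- gamma)"
  define gap where "gap t = util (zs t) t + lam * (surplus c t - zs t) - util (surplus c t) t" for t
  have lam: "0 \<le> lam" by (simp add: lam_def)
  note budget = surplus_budget[OF adm]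
  have i1: "set_integrable lborel {0..} (\<lambda>t. lam * (surplus c t - zs t))"
    by (intro set_integrable_mult_right set_integral_diff budget zs_integral)
  have i2: "set_integrable lborel {0..} gap"
    unfolding gap_def by (intro set_integral_diff set_integral_add i1 int zs_integral)
  have "(\<integral>t\<in>{0..}. gap t \<partial>lborel) = (\<integral>t\<in>{0..}. util (zs t) t \<partial>lborel)
      + lam * ((\<integral>t\<in>{0..}. surplus c t \<partial>lborel) - g0) - (\<integral>t\<in>{0..}. util (surplus c t) t \<partial>lborel)"
    unfolding gap_def
    using i1 int zs_integral budget
    by (simp add: set_integral_diff set_integral_add)
  then have gap_le: "(\<integral>t\<in>{0..}. gap t \<partial>lborel)
      \<le> (\<integral>t\<in>{0..}. util (zs t) t \<partial>lborel) - (\<integral>t\<in>{0..}. util (surplus c t) t \<partial>lborel)"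
    using budget(2) lam by (simp add: mult_le_0_iff)
  have "AE t in lborel. t \<ge> 0 \<longrightarrow> surplus c t \<ge> 0 \<and> (gamma < 1 \<or> surplus c t > 0)"
    using admissible_surplus_nonneg[OF adm] pos by (cases "gamma < 1") auto
  then have gap_pos: "AE t in lborel. t \<ge> 0 \<longrightarrow> 0 \<le> gap t \<and> (gap t = 0 \<longrightarrow> surplus c t = zs t)"
  proof eventually_elim
    case (elim t)
    then show ?case
      using util_tangent[of "surplus c t" t]
      by (cases "surplus c t = zs t") (auto simp: gap_def lam_def)
  qed
  have gap_nonneg: "AE t in lborel. 0 \<le> indicator {0..} t *\<^sub>R gap t"
    using gap_pos by eventually_elim (auto simp: indicator_def)
  then have nn: "0 \<le> (\<integral>t\<in>{0..}. gap t \<partial>lborel)"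
    unfolding set_lebesgue_integral_def by (rule integral_nonneg_AE)
  then show "(\<integral>t\<in>{0..}. util (surplus c t) t \<partial>lborel) \<le> (\<integral>t\<in>{0..}. util (zs t) t \<partial>lborel)"
    using gap_le by simp
  assume "(\<integral>t\<in>{0..}. util (surplus c t) t \<partial>lborel) = (\<integral>t\<in>{0..}. util (zs t) t \<partial>lborel)"
  then have "(\<integral>t\<in>{0..}. gap t \<partial>lborel) = 0"
    using gap_le nn by simp
  then have "AE t in lborel. indicator {0..} t *\<^sub>R gap t = 0"
    using integral_nonneg_eq_0_iff_AE[OF i2[unfolded set_integrable_def] gap_nonneg]
    unfolding set_lebesgue_integral_def by simp
  with gap_pos show "AE t in lborel. t \<ge> 0 \<longrightarrow> surplus c t = zs t"
    by eventually_elim (auto simp: indicator_def)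
qed

text \<open>Reduces the extended-real objective to a Bochner integral. For \<open>gamma < 1\<close>
  the tangent at \<open>zs\<close> is an integrable majorant, so every admissible control is
  \<open>regular\<close>. For \<open>gamma > 1\<close> a finite objective forces a positive
  \<open>surplus\<close> almost everywhere; this must be part of \<open>regular\<close>, since
  \<open>util\<close> returns 0 at \<open>z = 0\<close>, where the objective has minus
  infinity.\<close>

lemma objective_eq:
  assumes adm: "admissible A delta eps eta tau k0 c0 c"
  defines "regular \<equiv> (gamma < 1 \<or> (AE t in lborel. t \<ge> 0 \<longrightarrow> surplus c t > 0)) \<and>
    set_integrable lborel {0..} (\<lambda>t. util (surplus c t) t)"
  shows "(objective rho gamma eps eta tau c0 c = - \<infinity> \<or> regular) \<and>
    (regular \<longrightarrow> objective rho gamma eps eta tau c0 c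
      = ereal (\<integral>t\<in>{0..}. util (surplus c t) t \<partial>lborel))"
proof -
  define z where "z t = indicator {0..} t *\<^sub>R surplus c t" for t
  note budget = surplus_budget[OF adm]
  have [measurable]: "z \<in> borel_measurable borel"
    using budget(1) unfolding z_def set_integrable_def by (auto dest: borel_measurable_integrable)
  define w where "w t = indicator {0..} t *\<^sub>R util (z t) t" for t
  have [measurable]: "w \<in> borel_measurable borel"
    unfolding w_def util_def by measurable
  have w_eq: "(\<lambda>t. indicator {0..} t *\<^sub>R util (surplus c t) t) = w"
    by (auto simp: w_def z_def indicator_def fun_eq_iff)
  have set_eq: "set_integrable lborel {0..} (\<lambda>t. util (surplus c t) t) \<longleftrightarrow> integrable lborel w"
    "(\<integral>t\<in>{0..}. util (surplus c t) t \<partial>lborel) = (\<integral>t. w t \<partial>lborel)"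
    by (simp_all only: set_integrable_def set_lebesgue_integral_def w_eq)
  note nonneg = admissible_surplus_nonneg[OF adm]
  show ?thesis
  proof (cases "gamma < 1")
    case True
    have w_nonneg: "0 \<le> w t" for t
      using True by (simp add: w_def util_def)
    let ?bound = "\<lambda>t. indicator {0..} t *\<^sub>R
      (util (zs t) t + (mu * g0) powr (- gamma) * (surplus c t - zs t))"
    have int: "integrable lborel w"
    proof (rule Bochner_Integration.integrable_bound)
      show "integrable lborel ?bound"
        unfolding set_integrable_def[symmetric]
        by (intro set_integral_add set_integrable_mult_right set_integral_diff budget zs_integral)
      show "AE t in lborel. norm (w t) \<le> norm (?bound t)"
        using nonneg
      proof eventually_elim
        case (elim t)
        have "w t \<le> ?bound t"
          using elim True util_tangent[of "surplus c t" t]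
          by (cases "surplus c t = zs t") (auto simp: w_def z_def indicator_def)
        then show ?case
          using w_nonneg[of t] by simp
      qed
    qed simp
    have "(\<integral>\<^sup>+ t\<in>{0..}. ennreal ((max 0 (c t - habit eps eta tau c0 c t)) powr (1 - gamma)
        / (1 - gamma) * exp (- rho * t)) \<partial>lborel) = (\<integral>\<^sup>+ t. ennreal (w t) \<partial>lborel)"
    proof (rule nn_integral_cong_AE)
      show "AE t in lborel. ennreal ((max 0 (c t - habit eps eta tau c0 c t)) powr (1 - gamma)
        / (1 - gamma) * exp (- rho * t)) * indicator {0..} t = ennreal (w t)"
        using nonneg
      proof eventually_elim
        case (elim t)
        have "max 0 (c t - habit eps eta tau c0 c t) = exp (r * t) * surplus c t" if "t \<ge> 0"
          unfolding surplus_eq[OF that] using elim that by simp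
        then show ?case
          by (auto simp: w_def z_def util_def indicator_def)
      qed
    qed
    also have "\<dots> = ennreal (\<integral>t. w t \<partial>lborel)"
      using int w_nonneg by (intro nn_integral_eq_integral) auto
    finally show ?thesis
      using True int w_nonneg by (simp add: objective_def regular_def set_eq)
  next
    case False
    then have g: "gamma > 1"
      using gamma_neq_1 by simp
    have w_nonpos: "w t \<le> 0" for t
      using g by (simp add: w_def util_def divide_nonneg_neg mult_nonpos_nonneg indicator_def)
    define f where "f t = (if t \<in> {0..} then if z t > 0 then ennreal (- w t) else \<infinity> else 0)" for t
    have [measurable]: "f \<in> borel_measurable borel"
      unfolding f_def by measurable
    have "(if c t - habit eps eta tau c0 c t > 0
           then ennreal ((c t - habit eps eta tau c0 c t) powr (1 - gamma) / (gamma - 1)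
                         * exp (- rho * t))
           else \<infinity>) * indicator {0..} t = f t" for t
    proof (cases "t \<ge> 0")
      case True
      have "a / (gamma - 1) = - (a / (1 - gamma))" for a
        using g by (simp add: field_simps)
      then show ?thesis
        unfolding surplus_eq[OF True] using True
        by (simp add: f_def z_def w_def util_def zero_less_mult_iff)
    qed (simp add: f_def)
    then have obj: "objective rho gamma eps eta tau c0 c = - enn2ereal (\<integral>\<^sup>+ t. f t \<partial>lborel)"
      using False by (simp add: objective_def)
    have f_w: "(\<integral>\<^sup>+ t. f t \<partial>lborel) = (\<integral>\<^sup>+ t. ennreal (- w t) \<partial>lborel)"
      if "AE t in lborel. t \<ge> 0 \<longrightarrow> surplus c t > 0"
    proof (rule nn_integral_cong_AE)
      show "AE t in lborel. f t = ennreal (- w t)"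
        using that by eventually_elim (auto simp: f_def z_def w_def)
    qed
    have "regular" if fin: "(\<integral>\<^sup>+ t. f t \<partial>lborel) \<noteq> \<infinity>"
    proof -
      have "AE t in lborel. f t \<noteq> \<infinity>"
        using fin by (intro nn_integral_PInf_AE) auto
      then have pos: "AE t in lborel. t \<ge> 0 \<longrightarrow> surplus c t > 0"
        by eventually_elim (auto simp: f_def z_def split: if_splits)
      have "integrable lborel (\<lambda>t. - w t)"
        using fin f_w[OF pos] w_nonpos by (intro integrableI_nonneg) (auto simp: less_top)
      then show ?thesis
        using pos by (simp add: regular_def set_eq)
    qed
    moreover have "objective rho gamma eps eta tau c0 c = ereal (\<integral>t. w t \<partial>lborel)" if regular
    proof -
      have pos: "AE t in lborel. t \<ge> 0 \<longrightarrow> surplus c t > 0" and int: "integrable lborel w"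
        using that False by (auto simp: regular_def set_eq)
      have "(\<integral>\<^sup>+ t. ennreal (- w t) \<partial>lborel) = ennreal (\<integral>t. - w t \<partial>lborel)"
        using int w_nonpos by (intro nn_integral_eq_integral) auto
      moreover have "0 \<le> (\<integral>t. - w t \<partial>lborel)"
        using w_nonpos by (intro integral_nonneg_AE) auto
      ultimately show ?thesis
        by (simp add: obj f_w[OF pos])
    qed
    ultimately show ?thesis
      by (auto simp: obj set_eq)
  qed
qed

section \<open>Recovering consumption from its surplus\<close>

lemma path_unique:
  assumes c: "locally_integrable c" and c': "locally_integrable c'"
    and eq: "AE t in lborel. t \<ge> 0 \<longrightarrow> surplus c t = surplus c' t"
  shows "AE t in lborel. t \<ge> 0 \<longrightarrow> c t = c' t"
    and "t \<ge> 0 \<Longrightarrow> surplus c t = surplus c' t \<Longrightarrow> c t = c' t"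
proof -
  \<comment> \<open>Both paths share the history, so \<open>d\<close> vanishes before 0 and equal
    surpluses turn into \<open>d = conv d\<close>.\<close>
  define d where "d u = disc c u - disc c' u" for u
  have past_d: "past T d = (\<lambda>u. past T (disc c) u - past T (disc c') u)" for T
    by (auto simp: past_def d_def fun_eq_iff algebra_simps)
  have int: "integrable lborel (past T d)" for T
    unfolding past_d using integrable_past_disc c c' by simp
  have conv_d: "conv d t = conv (disc c) t - conv (disc c') t" for t
    using conv_diff[OF integrable_past_disc[OF c, of t] integrable_past_disc[OF c', of t], of t]
    by (simp add: conv_past flip: past_d)
  have d_neg: "d t = 0" if "t < 0" for t
    using that by (simp add: d_def disc_def ctilde_def)
  have conv_neg: "conv d t = 0" if "t < 0" for t
  proof -
    have "ker (t - u) * d u = 0" for u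
      using that d_neg by (cases "u < 0") (auto simp: ker_outside)
    then show ?thesis
      by (simp only: conv_def) simp
  qed
  have "AE t in lborel. d t = conv d t"
    using eq
  proof eventually_elim
    case (elim t)
    then show ?case
      using d_neg[of t] conv_neg[of t] conv_d[of t] by (cases "t < 0") (auto simp: d_def surplus_def)
  qed
  note d0 = conv_fixed_point_unique[OF int this]
  from d0(1) show "AE t in lborel. t \<ge> 0 \<longrightarrow> c t = c' t"
    by eventually_elim (auto simp: d_def disc_present)
  show "c t = c' t" if "t \<ge> 0" "surplus c t = surplus c' t"
    using that d0(2)[of t] conv_d[of t] by (simp add: surplus_def disc_present)
qed

text \<open>By linearity discounted consumption is a known history \<open>D\<close> plus an unknown
  future \<open>y\<close>, and the target becomes \<open>y = b + conv y\<close> with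
  \<open>b = zs + conv D\<close>: the prescribed surplus plus the inherited habit. As
  \<open>b\<close> is nonnegative and bounded, so is the solution.\<close>

lemma path_exists:
  obtains c where "\<And>t. t \<ge> 0 \<Longrightarrow> 0 \<le> c t" "locally_integrable c"
    "\<And>t. t \<ge> 0 \<Longrightarrow> surplus c t = zs t"
proof -
  define D where "D = disc (\<lambda>_. 0)"
  have "locally_integrable (\<lambda>_. 0)"
    by (simp add: locally_integrable_def set_integrable_def)
  from integrable_past_disc[OF this, of 0] have D: "integrable lborel D"
    by (rule back_subst[where P = "integrable lborel"])
       (auto simp: past_def D_def disc_def ctilde_def indicator_def fun_eq_iff)
  have D_nonneg: "0 \<le> D u" for u
    unfolding D_def by (rule disc_nonneg) simp
  have [measurable]: "conv D \<in> borel_measurable borel"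
    using integral_conv(1)[OF D] by (auto dest: borel_measurable_integrable)
  define b where "b t = (if t < 0 then 0 else zs t + conv D t)" for t
  have conv_D: "conv D t \<le> eps * (\<integral>u. D u \<partial>lborel)" for t
  proof -
    have "conv D t \<le> (\<integral>u. eps * D u \<partial>lborel)"
      unfolding conv_def using D
      by (intro integral_mono integrable_ker_mult) (auto intro!: mult_right_mono ker_le D_nonneg)
    then show ?thesis by simp
  qed
  have zs_le: "zs t \<le> mu * g0" if "t \<ge> 0" for t
    using that mu_pos g0_pos by (simp add: zs_def)
  have b: "b \<in> borel_measurable borel" "\<And>t. 0 \<le> b t"
    "\<And>t. b t \<le> mu * g0 + eps * (\<integral>u. D u \<partial>lborel)" "\<And>t. t < 0 \<Longrightarrow> b t = 0"
  proof -
    show "b \<in> borel_measurable borel"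
      unfolding b_def zs_def by measurable
    show "0 \<le> b t" for t
      using conv_nonneg[of D t, OF D_nonneg] zs_pos[of t] by (simp add: b_def)
    show "b t \<le> mu * g0 + eps * (\<integral>u. D u \<partial>lborel)" for t
    proof (cases "t < 0")
      case True
      have "0 \<le> conv D t" by (rule conv_nonneg[OF D_nonneg])
      with conv_D[of t] mu_pos g0_pos True show ?thesis
        by (simp add: b_def)
    next
      case False
      with conv_D[of t] zs_le[of t] show ?thesis
        by (simp add: b_def)
    qed
  qed (simp add: b_def)
  obtain y M where [measurable]: "y \<in> borel_measurable borel"
    and y: "\<And>t. 0 \<le> y t" "\<And>t. y t \<le> M" "\<And>t. t < 0 \<Longrightarrow> y t = 0" "\<And>t. y t = b t + conv y t"
    using conv_fixed_point_exists[OF b] by metis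
  define c where "c t = exp (r * t) * y t" for t
  have c: "locally_integrable c"
    unfolding locally_integrable_def set_integrable_def
  proof (intro allI impI)
    fix T :: real assume "0 \<le> T"
    show "integrable lborel (\<lambda>t. indicator {0..T} t *\<^sub>R c t)"
    proof (rule Bochner_Integration.integrable_bound)
      show "integrable lborel (\<lambda>t. indicator {0..T} t *\<^sub>R (exp (r * T) * M))"
        using \<open>0 \<le> T\<close> by (simp add: integrable_real_indicator)
      have "\<bar>exp (r * t) * y t\<bar> \<le> exp (r * T) * M" if "t \<in> {0..T}" for t
        using that y(1,2)[of t] r_pos by (auto simp: abs_mult intro!: mult_mono)
      then show "AE t in lborel. norm (indicator {0..T} t *\<^sub>R c t)
          \<le> norm (indicator {0..T} t *\<^sub>R (exp (r * T) * M))"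
        by (auto simp: c_def indicator_def intro: order_trans[OF _ abs_ge_self])
    qed (simp add: c_def)
  qed
  have disc_c: "disc c u = D u + y u" for u
    using y(3)[of u] tau_gt_0
    by (auto simp: disc_def D_def ctilde_def c_def simp flip: exp_add mult.assoc)
  show thesis
  proof (rule that)
    show "0 \<le> c t" for t
      by (simp add: c_def y(1))
    show "locally_integrable c" by fact
    fix t :: real assume t: "t \<ge> 0"
    have pD: "integrable lborel (past t D)"
      using integrable_mult_indicator[OF _ D, of "{..t}"] by (simp add: past_def[abs_def])
    have py: "past t y = (\<lambda>u. past t (disc c) u - past t D u)"
      by (auto simp: past_def disc_c fun_eq_iff algebra_simps)
    have "conv y t = conv (disc c) t - conv D t"
      using conv_diff[OF integrable_past_disc[OF c, of t] pD, of t]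
      by (simp add: conv_past flip: py)
    moreover have "disc c t = y t"
      unfolding disc_c using t by (simp add: D_def disc_present)
    ultimately show "surplus c t = zs t"
      using y(4)[of t] t by (simp add: surplus_def b_def)
  qed
qed

section \<open>Admissibility, policy and optimality along the candidate\<close>

lemma wealth_along_zs:
  assumes c: "locally_integrable c" and eq: "\<And>t. t \<ge> 0 \<Longrightarrow> surplus c t = zs t" and t: "t \<ge> 0"
  shows "wealth c t = g0 * exp (- mu * t)"
proof -
  have "has_bochner_integral lborel (\<lambda>u. zs u * indicator {0..t} u)
      (- g0 * exp (- mu * t) - - g0 * exp (- mu * 0))"
    unfolding zs_def[abs_def] using t
    by (intro has_bochner_integral_FTC_Icc_real)
       (auto intro!: derivative_eq_intros continuous_intros)
  then have "(\<integral>u\<in>{0..t}. zs u \<partial>lborel) = g0 - g0 * exp (- mu * t)"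
    by (simp add: has_bochner_integral_iff set_lebesgue_integral_def mult.commute[of _ "indicator _ _"])
  moreover have "(\<integral>u\<in>{0..t}. surplus c u \<partial>lborel) = (\<integral>u\<in>{0..t}. zs u \<partial>lborel)"
    by (rule set_lebesgue_integral_cong) (auto simp: eq)
  ultimately show ?thesis
    using wealth_flow[OF c t] wealth_0[OF c] by simp
qed

text \<open>The capital constraint, so far replaced by one budget, is checked at every time:
  \<open>K\<close> times discounted capital is \<open>wealth\<close> plus \<open>pending\<close>,
  and \<open>pending\<close> is nonnegative because consumption is.\<close>

lemma admissible_along_zs:
  assumes nn: "\<And>t. t \<ge> 0 \<Longrightarrow> 0 \<le> c t" and c: "locally_integrable c"
    and eq: "\<And>t. t \<ge> 0 \<Longrightarrow> surplus c t = zs t"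
  shows "admissible A delta eps eta tau k0 c0 c"
proof -
  have "0 \<le> capital A delta k0 c t" if t: "t \<ge> 0" for t
  proof -
    have "0 \<le> wealth c t"
      using g0_pos by (simp add: wealth_along_zs[OF c eq t])
    then have "0 \<le> K * (k0 - (\<integral>u\<in>{0..t}. disc c u \<partial>lborel))"
      using pending_nonneg[of "disc c" t, OF disc_nonneg[OF nn]] by (simp add: wealth_def)
    then show ?thesis
      using K_pos by (simp add: capital_eq zero_le_mult_iff)
  qed
  moreover have "habit eps eta tau c0 c t \<le> c t" if "t \<ge> 0" for t
    using surplus_eq[OF that, of c] eq[OF that] zs_pos[of t]
    by (smt (verit) exp_gt_zero mult_pos_pos)
  ultimately show ?thesis
    using nn c by (auto simp: admissible_def locally_integrable_def)
qed

text \<open>The policy makes \<open>wealth\<close> a constant multiple of \<open>surplus\<close>,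
  hence locally integrable, and \<open>wealth_flow\<close> becomes a linear integral equation; no
  continuity of the control is assumed.\<close>

lemma closed_loop_iff_surplus:
  assumes c: "locally_integrable c"
  shows "(\<forall>t\<ge>0. closed_loop A delta rho eps eta tau gamma k0 c0 c t) \<longleftrightarrow> (\<forall>t\<ge>0. surplus c t = zs t)"
proof
  assume "\<forall>t\<ge>0. surplus c t = zs t"
  then show "\<forall>t\<ge>0. closed_loop A delta rho eps eta tau gamma k0 c0 c t"
    using closed_loop_eq[OF _ integrable_past_disc[OF c]] wealth_along_zs[OF c]
    by (simp add: zs_def)
next
  assume "\<forall>t\<ge>0. closed_loop A delta rho eps eta tau gamma k0 c0 c t"
  then have cl: "surplus c t = mu * wealth c t" if "t \<ge> 0" for t
    using closed_loop_eq[OF _ integrable_past_disc[OF c]] that by blast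
  have w: "wealth c t = surplus c t / mu" if "t \<ge> 0" for t
    using cl[OF that] mu_pos by simp
  have "wealth c t = g0 * exp (- mu * t)" if "t \<ge> 0" for t
  proof (rule exponential_of_integral_equation[OF _ _ that])
    fix T :: real assume T: "T \<ge> 0"
    have "set_integrable lborel {0..T} (\<lambda>t. surplus c t / mu)"
      using surplus_integrable(3)[OF c T] by (rule set_integrable_divide)
    then show "set_integrable lborel {0..T} (wealth c)"
      by (subst set_integrable_cong[where f' = "\<lambda>t. surplus c t / mu"]) (auto simp: w)
    have "(\<integral>u\<in>{0..T}. surplus c u \<partial>lborel) = (\<integral>u\<in>{0..T}. mu * wealth c u \<partial>lborel)"
      by (rule set_lebesgue_integral_cong) (auto simp: cl)
    then show "wealth c T = g0 - mu * (\<integral>u\<in>{0..T}. wealth c u \<partial>lborel)"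
      using wealth_flow[OF c T] wealth_0[OF c] by simp
  qed
  then show "\<forall>t\<ge>0. surplus c t = zs t"
    using cl by (simp add: zs_def)
qed

text \<open>The candidate has a finite value, so another optimal control cannot have value minus
  infinity; it is \<open>regular\<close> and falls under the equality case of the
  comparison.\<close>

lemma optimal_along_zs:
  assumes adm: "admissible A delta eps eta tau k0 c0 c"
    and eq: "\<And>t. t \<ge> 0 \<Longrightarrow> surplus c t = zs t"
  shows "optimal A delta rho eps eta tau gamma k0 c0 c"
    and "optimal A delta rho eps eta tau gamma k0 c0 c' \<Longrightarrow>
      AE t in lborel. t \<ge> 0 \<longrightarrow> surplus c' t = zs t"
proof -
  let ?V = "\<integral>t\<in>{0..}. util (zs t) t \<partial>lborel"
  have "(\<integral>t\<in>{0..}. util (surplus c t) t \<partial>lborel) = ?V"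
    by (rule set_lebesgue_integral_cong) (auto simp: eq)
  moreover have "set_integrable lborel {0..} (\<lambda>t. util (surplus c t) t)"
    using zs_integral(3) by (subst set_integrable_cong[where f' = "\<lambda>t. util (zs t) t"]) (auto simp: eq)
  moreover have "AE t in lborel. t \<ge> 0 \<longrightarrow> surplus c t > 0"
    by (simp add: eq zs_pos)
  ultimately have obj: "objective rho gamma eps eta tau c0 c = ereal ?V"
    using objective_eq[OF adm] by simp
  show opt: "optimal A delta rho eps eta tau gamma k0 c0 c"
    unfolding optimal_def
  proof (intro conjI allI impI adm)
    fix c' assume adm': "admissible A delta eps eta tau k0 c0 c'"
    show "objective rho gamma eps eta tau c0 c' \<le> objective rho gamma eps eta tau c0 c"
      using objective_eq[OF adm'] util_integral_le(1)[OF adm'] unfolding obj by auto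
  qed
  assume opt': "optimal A delta rho eps eta tau gamma k0 c0 c'"
  then have adm': "admissible A delta eps eta tau k0 c0 c'"
    and "objective rho gamma eps eta tau c0 c' = ereal ?V"
    using opt adm unfolding obj[symmetric] by (auto simp: optimal_def intro: order.antisym)
  then show "AE t in lborel. t \<ge> 0 \<longrightarrow> surplus c' t = zs t"
    using objective_eq[OF adm'] util_integral_le(2)[OF adm'] by auto
qed

end

theorem mainTheorem13:
  fixes A delta rho eps eta tau gamma k0 :: real and c0 :: "real \<Rightarrow> real"
  assumes "A > 0" "delta > 0" "rho > 0" "eps > 0" "eta > 0" "tau > 0"
    and "gamma > 0" "gamma \<noteq> 1"
    and "lambda0 eps eta tau < eps - eta" "eps - eta \<le> 0" "0 < A - delta"
    and "rho > (A - delta) * (1 - gamma)"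
    and "k0 > 0"
    and "\<forall>u\<in>{-tau..<0}. c0 u \<ge> 0"
    and "set_borel_measurable lborel {-tau..<0} c0"
    and "set_integrable lborel {-tau..<0} (\<lambda>u. (c0 u)\<^sup>2)"
    and "setI A delta eps eta tau k0 (q1 eps eta tau c0)"
  shows "\<exists>cs. optimal A delta rho eps eta tau gamma k0 c0 cs
           \<and> (\<forall>c. optimal A delta rho eps eta tau gamma k0 c0 c \<longrightarrow>
                  (AE t in lborel. t \<ge> 0 \<longrightarrow> c t = cs t))
           \<and> (\<forall>t\<ge>0. closed_loop A delta rho eps eta tau gamma k0 c0 cs t)
           \<and> (\<forall>c. admissible A delta eps eta tau k0 c0 c
                  \<and> (\<forall>t\<ge>0. closed_loop A delta rho eps eta tau gamma k0 c0 c t)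
                  \<longrightarrow> (\<forall>t\<ge>0. c t = cs t))"
proof -
  interpret habit_economy A delta "A - delta" "A - delta + eta" rho eps eta tau gamma k0 c0
    using assms by unfold_locales (auto simp: setI_def)
  obtain cs where cs: "\<And>t. t \<ge> 0 \<Longrightarrow> 0 \<le> cs t" "locally_integrable cs"
    "\<And>t. t \<ge> 0 \<Longrightarrow> surplus cs t = zs t"
    using path_exists by blast
  have adm: "admissible A delta eps eta tau k0 c0 cs"
    using cs by (rule admissible_along_zs)
  show ?thesis
  proof (intro exI[of _ cs] conjI allI impI)
    show "optimal A delta rho eps eta tau gamma k0 c0 cs"
      using adm cs(3) by (rule optimal_along_zs(1))
    show "closed_loop A delta rho eps eta tau gamma k0 c0 cs t" if "t \<ge> 0" for t
      using closed_loop_iff_surplus[OF cs(2)] cs(3) that by blast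
  next
    fix c assume opt: "optimal A delta rho eps eta tau gamma k0 c0 c"
    then have "locally_integrable c"
      by (auto simp: optimal_def intro: admissible_locally_integrable)
    moreover have "AE t in lborel. t \<ge> 0 \<longrightarrow> surplus c t = zs t"
      using adm cs(3) opt by (rule optimal_along_zs(2))
    then have "AE t in lborel. t \<ge> 0 \<longrightarrow> surplus c t = surplus cs t"
      by eventually_elim (simp add: cs(3))
    ultimately show "AE t in lborel. t \<ge> 0 \<longrightarrow> c t = cs t"
      using path_unique(1) cs(2) by blast
  next
    fix c t assume c: "admissible A delta eps eta tau k0 c0 c
      \<and> (\<forall>t\<ge>0. closed_loop A delta rho eps eta tau gamma k0 c0 c t)" and t: "(t::real) \<ge> 0"
    then have li: "locally_integrable c"
      by (auto intro: admissible_locally_integrable)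
    then have "surplus c t = surplus cs t" if "t \<ge> 0" for t
      using c cs(3) closed_loop_iff_surplus that by auto
    \<comment> \<open>The policy holds at every time, so the pointwise half of
      \<open>path_unique\<close> applies; an optimal control determines consumption only up to a
      null set.\<close>
    then show "c t = cs t"
      using path_unique(2)[OF li cs(2)] t by auto
  qed
qed

end
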